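(* The call-by-value catch/throw calculus has the Church–Rosser property: if $M_1$ and $M_2$ are equal in the congruence generated by its reduction rules, then there is a term $N$ with $M_1\to^*N$ and $M_2\to^*N$.
   Context: Call-by-value catch/throw calculus. Ordinary variables $x,y,z,\dots$ and continuation variables $k,l,\delta,\dots$ are disjoint. Terms: $M ::= x \mid \lambda x.M \mid MM \mid (M\ \mathsf{where}\ x:=M) \mid \varepsilon k.M \mid \mathsf{throw}_k M$, where $(L\ \mathsf{where}\ x:=M)$ means $\mathsf{let}\ x=M\ \mathsf{in}\ L$ ($x$ bound in $L$ only), $\varepsilon k$ binds $k$ (an exception block tagged $k$), and $\mathsf{throw}_k M$ raises $M$ to the block tagged $k$ ($k$ free). Terms are identified up to $\alpha$-conversion and the congruence generated by: $(L\ \mathsf{where}\ x:=(M\ \mathsf{where}\ y:=N))=((L\ \mathsf{where}\ x:=M)\ \mathsf{where}\ y:=N)$ if $y$ not free in $L$; $((\varepsilon k.M)\ \mathsf{where}\ x:=N)=\varepsilon k.(M\ \mathsf{where}\ x:=N)$ if $k$ not free in $N$; $((\mathsf{throw}_k M)\ \mathsf{where}\ x:=N)=\mathsf{throw}_k(M\ \mathsf{where}\ x:=N)$. Values $V$: variables and $\lambda$-abstractions; other terms are non-values ($N$ below). Reduction rules ($z$ fresh): $NM\to(zM\ \mathsf{where}\ z:=N)$; $VN\to(Vz\ \mathsf{where}\ z:=N)$; $(\lambda x.M)V\to(M\ \mathsf{where}\ x:=V)$; $(M\ \mathsf{where}\ x:=V)\to M\{V/x\}$; $\lambda x.Vx\to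 V$ ($x$ not free in $V$); $(x\ \mathsf{where}\ x:=M)\to M$; $\varepsilon\delta.M\to M$ ($\delta$ not free in $M$); $\varepsilon k.\mathsf{throw}_kM\to\varepsilon k.M$; $(M\ \mathsf{where}\ x:=\mathsf{throw}_kN)\to\mathsf{throw}_kN$; $\mathsf{throw}_l\mathsf{throw}_kN\to\mathsf{throw}_kN$; $(M\ \mathsf{where}\ x:=\varepsilon k.N)\to\varepsilon k.(M\ \mathsf{where}\ x:=N\{\mathsf{throw}_k\square\mapsto\mathsf{throw}_k(M\ \mathsf{where}\ x:=\square)\})$; $\mathsf{throw}_l\varepsilon k.M\to\mathsf{throw}_l(M\{l/k\})$; $\varepsilon l.\varepsilon k.M\to\varepsilon l.M\{l/k\}$. Here $\{\mathsf{throw}_k\square\mapsto\mathsf{throw}_k(M\ \mathsf{where}\ x:=\square)\}$ replaces recursively each subterm $\mathsf{throw}_kQ$ with $k$ free by $\mathsf{throw}_k(M\ \mathsf{where}\ x:=Q)$ (capture-avoiding), and $\{l/k\}$ replaces each such $\mathsf{throw}_kQ$ by $\mathsf{throw}_lQ$. $\to$ is the compatible closure, $\to^*$ its reflexive-transitive closure. *)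

theory Defs
  imports Main
begin

text \<open>Call-by-value catch/throw calculus, de Bruijn encoding.
Two independent index spaces: ordinary variables (bound by Lam and by the
body of Wh) and continuation variables (bound by Eps, used in Thr).
  Wh L M  stands for  (L where x := M), x = ordinary index 0 in L.
  Eps M   stands for  eps k. M, k = continuation index 0 in M.
  Thr k M stands for  throw_k M.\<close>

datatype trm =
    Var nat
  | Lam trm
  | App trm trm
  | Wh trm trm
  | Eps trm
  | Thr nat trm

fun is_val :: "trm \<Rightarrow> bool" where
  "is_val (Var _) = True"
| "is_val (Lam _) = True"
| "is_val _ = False"

fun lift_x :: "nat \<Rightarrow> trm \<Rightarrow> trm" where
  "lift_x c (Var i) = Var (if i < c then i else Suc i)"
| "lift_x c (Lam M) = Lam (lift_x (Suc c) M)"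
| "lift_x c (App M N) = App (lift_x c M) (lift_x c N)"
| "lift_x c (Wh L M) = Wh (lift_x (Suc c) L) (lift_x c M)"
| "lift_x c (Eps M) = Eps (lift_x c M)"
| "lift_x c (Thr k M) = Thr k (lift_x c M)"

fun lift_k :: "nat \<Rightarrow> trm \<Rightarrow> trm" where
  "lift_k c (Var i) = Var i"
| "lift_k c (Lam M) = Lam (lift_k c M)"
| "lift_k c (App M N) = App (lift_k c M) (lift_k c N)"
| "lift_k c (Wh L M) = Wh (lift_k c L) (lift_k c M)"
| "lift_k c (Eps M) = Eps (lift_k (Suc c) M)"
| "lift_k c (Thr k M) = Thr (if k < c then k else Suc k) (lift_k c M)"

fun subst_x :: "nat \<Rightarrow> trm \<Rightarrow> trm \<Rightarrow> trm" where
  "subst_x n V (Var i) = (if i < n then Var i else if i = n then V else Var (i - 1))"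
| "subst_x n V (Lam M) = Lam (subst_x (Suc n) (lift_x 0 V) M)"
| "subst_x n V (App M N) = App (subst_x n V M) (subst_x n V N)"
| "subst_x n V (Wh L M) = Wh (subst_x (Suc n) (lift_x 0 V) L) (subst_x n V M)"
| "subst_x n V (Eps M) = Eps (subst_x n (lift_k 0 V) M)"
| "subst_x n V (Thr k M) = Thr k (subst_x n V M)"

fun subst_k :: "nat \<Rightarrow> nat \<Rightarrow> trm \<Rightarrow> trm" where
  "subst_k n l (Var i) = Var i"
| "subst_k n l (Lam M) = Lam (subst_k n l M)"
| "subst_k n l (App M N) = App (subst_k n l M) (subst_k n l N)"
| "subst_k n l (Wh L M) = Wh (subst_k n l L) (subst_k n l M)"
| "subst_k n l (Eps M) = Eps (subst_k (Suc n) l M)"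
| "subst_k n l (Thr j M) =
     Thr (if j < n then j else if j = n then l + n else j - 1) (subst_k n l M)"

text \<open>Structural replacement N{throw_k [] |-> throw_k (P where x := [])}.
  P is the body of the where (ordinary index 0 is x); it is shifted when
  passing binders (capture avoidance); replacement is recursive.\<close>
fun repl :: "nat \<Rightarrow> trm \<Rightarrow> trm \<Rightarrow> trm" where
  "repl k P (Var i) = Var i"
| "repl k P (Lam M) = Lam (repl k (lift_x 1 P) M)"
| "repl k P (App M N) = App (repl k P M) (repl k P N)"
| "repl k P (Wh L M) = Wh (repl k (lift_x 1 P) L) (repl k P M)"
| "repl k P (Eps M) = Eps (repl (Suc k) (lift_k 0 P) M)"
| "repl k P (Thr j M) =
     (if j = k then Thr j (Wh P (repl k P M)) else Thr j (repl k P M))"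

inductive sc :: "trm \<Rightarrow> trm \<Rightarrow> bool" where
  sc_assoc: "sc (Wh L (Wh M N)) (Wh (Wh (lift_x 1 L) M) N)"
| sc_eps:   "sc (Wh (Eps M) N) (Eps (Wh M (lift_k 0 N)))"
| sc_thr:   "sc (Wh (Thr k M) N) (Thr k (Wh M N))"
| sc_refl:  "sc M M"
| sc_sym:   "sc M N \<Longrightarrow> sc N M"
| sc_trans: "sc M N \<Longrightarrow> sc N P \<Longrightarrow> sc M P"
| sc_Lam:   "sc M M' \<Longrightarrow> sc (Lam M) (Lam M')"
| sc_App:   "sc M M' \<Longrightarrow> sc N N' \<Longrightarrow> sc (App M N) (App M' N')"
| sc_Wh:    "sc M M' \<Longrightarrow> sc N N' \<Longrightarrow> sc (Wh M N) (Wh M' N')"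
| sc_Eps:   "sc M M' \<Longrightarrow> sc (Eps M) (Eps M')"
| sc_Thr:   "sc M M' \<Longrightarrow> sc (Thr k M) (Thr k M')"

inductive rstep :: "trm \<Rightarrow> trm \<Rightarrow> bool" where
  r_app1:  "\<not> is_val N \<Longrightarrow> rstep (App N M) (Wh (App (Var 0) (lift_x 0 M)) N)"
| r_app2:  "is_val V \<Longrightarrow> \<not> is_val N \<Longrightarrow> rstep (App V N) (Wh (App (lift_x 0 V) (Var 0)) N)"
| r_beta:  "is_val V \<Longrightarrow> rstep (App (Lam M) V) (Wh M V)"
| r_let:   "is_val V \<Longrightarrow> rstep (Wh M V) (subst_x 0 V M)"
| r_eta:   "is_val V \<Longrightarrow> rstep (Lam (App (lift_x 0 V) (Var 0))) V"
| r_letid: "rstep (Wh (Var 0) M) M"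
| r_epsgc: "rstep (Eps (lift_k 0 M)) M"
| r_epsthr: "rstep (Eps (Thr 0 M)) (Eps M)"
| r_whthr: "rstep (Wh M (Thr k N)) (Thr k N)"
| r_thrthr: "rstep (Thr l (Thr k N)) (Thr k N)"
| r_wheps: "rstep (Wh M (Eps N))
              (Eps (Wh (lift_k 0 M) (repl 0 (lift_k 0 M) N)))"
| r_threps: "rstep (Thr l (Eps M)) (Thr l (subst_k 0 l M))"
| r_epseps: "rstep (Eps (Eps M)) (Eps (subst_k 0 0 M))"

inductive cstep :: "trm \<Rightarrow> trm \<Rightarrow> bool" where
  c_root: "rstep M N \<Longrightarrow> cstep M N"
| c_Lam:  "cstep M M' \<Longrightarrow> cstep (Lam M) (Lam M')"
| c_App1: "cstep M M' \<Longrightarrow> cstep (App M N) (App M' N)"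
| c_App2: "cstep N N' \<Longrightarrow> cstep (App M N) (App M N')"
| c_Wh1:  "cstep M M' \<Longrightarrow> cstep (Wh M N) (Wh M' N)"
| c_Wh2:  "cstep N N' \<Longrightarrow> cstep (Wh M N) (Wh M N')"
| c_Eps:  "cstep M M' \<Longrightarrow> cstep (Eps M) (Eps M')"
| c_Thr:  "cstep M M' \<Longrightarrow> cstep (Thr k M) (Thr k M')"

definition red :: "trm \<Rightarrow> trm \<Rightarrow> bool" where
  "red M N \<longleftrightarrow> (\<exists>M' N'. sc M M' \<and> cstep M' N' \<and> sc N' N)"

definition reds :: "trm \<Rightarrow> trm \<Rightarrow> bool" where
  "reds = (\<lambda>M N. red M N \<or> sc M N)\<^sup>*\<^sup>*"

definition conv :: "trm \<Rightarrow> trm \<Rightarrow> bool" where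
  "conv = equivclp (\<lambda>M N. red M N \<or> sc M N)"

end

theory Submission
  imports Defs "HOL-Library.Confluence"
begin

text \<open>
  Terms are translated to continuation-passing style, into a calculus of values and jumps in which
  all administrative redexes are contracted on the fly. The congruence and every reduction rule
  except beta and eta become identities; these two become the beta and eta rules of the CPS calculus,
  which is confluent by a diamond property of parallel reduction. Conversely, a jump is read back
  as a term in which exception blocks and throws occur only at the top of a function body. Every
  term reduces to the read-back of its translation, and parallel reduction of jumps is simulated by
  reduction of read-backs, so a common reduct in the CPS calculus is read back as one in the
  catch/throw calculus.
\<close>

section \<open>The CPS calculus\<close>

text \<open>Critical pairs of the source rules are hard to treat directly: reduction is modulo a
  congruence, and \<open>r_wheps\<close> copies the body of a let to every throw. In the target both
  are the substitution of one continuation for a name, so the translation equates their two sides.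
  The obstacle lies in coming back. Moreover, a target beta step replaces a name by a continuation
  everywhere, whereas \<open>repl\<close> inserts a let below each throw and keeps its label. The
  continuation is therefore first made to return to the name being replaced, and this name is
  identified with the real destination afterwards, by the rules that merge nested blocks and
  throws.\<close>

text \<open>
  \<open>Abs J\<close> binds an ordinary and a continuation variable. \<open>Ret k W\<close> passes \<open>W\<close> to
  continuation \<open>k\<close>; \<open>Call A B J\<close> applies \<open>A\<close> to \<open>B\<close> and to the continuation which binds
  ordinary index 0 in \<open>J\<close>. A continuation abstraction is never applied to a value: substituting the
  jump \<open>J\<close> for \<open>k\<close> in \<open>Ret k W\<close> instantiates \<open>J\<close> with \<open>W\<close>.
\<close>
datatype val = V nat | Abs jmp
     and jmp = Ret nat val | Call val val jmp

definition up :: "(nat \<Rightarrow> nat) \<Rightarrow> nat \<Rightarrow> nat" where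
  "up f = case_nat 0 (Suc \<circ> f)"

lemma up_simps [simp]: "up f 0 = 0" "up f (Suc n) = Suc (f n)"
  by (simp_all add: up_def)

lemma up_comp [simp]: "up f \<circ> up g = up (f \<circ> g)"
  by (auto simp: fun_eq_iff up_def split: nat.split)

lemma up_id [simp]: "up id = id"
  by (auto simp: fun_eq_iff up_def split: nat.split)

lemma up_Suc [simp]: "up f \<circ> Suc = Suc \<circ> f"
  by (auto simp: fun_eq_iff)

text \<open>
  Three simultaneous operations, on values (suffix \<open>v\<close>) and jumps (suffix \<open>j\<close>): \<open>rn\<close> renames
  both kinds of variables; \<open>vs\<close> substitutes values and renames continuation variables; \<open>sb\<close>
  substitutes values and jumps. The functions \<open>ux\<close>, \<open>tx\<close> push a substitution under an ordinary
  binder, \<open>ub\<close>, \<open>tb\<close> under the double binder of \<open>Abs\<close>.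
\<close>
primrec rnv :: "(nat \<Rightarrow> nat) \<Rightarrow> (nat \<Rightarrow> nat) \<Rightarrow> val \<Rightarrow> val"
    and rnj :: "(nat \<Rightarrow> nat) \<Rightarrow> (nat \<Rightarrow> nat) \<Rightarrow> jmp \<Rightarrow> jmp" where
  "rnv \<xi> \<zeta> (V i) = V (\<xi> i)"
| "rnv \<xi> \<zeta> (Abs J) = Abs (rnj (up \<xi>) (up \<zeta>) J)"
| "rnj \<xi> \<zeta> (Ret k W) = Ret (\<zeta> k) (rnv \<xi> \<zeta> W)"
| "rnj \<xi> \<zeta> (Call A B J) = Call (rnv \<xi> \<zeta> A) (rnv \<xi> \<zeta> B) (rnj (up \<xi>) \<zeta> J)"

lemma rn_rn [simp]:
  "rnv \<xi> \<zeta> (rnv \<xi>' \<zeta>' W) = rnv (\<xi> \<circ> \<xi>') (\<zeta> \<circ> \<zeta>') W"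
  "rnj \<xi> \<zeta> (rnj \<xi>' \<zeta>' J) = rnj (\<xi> \<circ> \<xi>') (\<zeta> \<circ> \<zeta>') J"
  by (induction W and J arbitrary: \<xi> \<zeta> \<xi>' \<zeta>' and \<xi> \<zeta> \<xi>' \<zeta>') simp_all

lemma rn_id [simp]: "rnv id id W = W" "rnj id id J = J"
  by (induction W and J) (simp_all del: id_apply, simp_all)

definition ux :: "(nat \<Rightarrow> val) \<Rightarrow> nat \<Rightarrow> val" where
  "ux \<sigma> = case_nat (V 0) (rnv Suc id \<circ> \<sigma>)"

definition ub :: "(nat \<Rightarrow> val) \<Rightarrow> nat \<Rightarrow> val" where
  "ub \<sigma> = case_nat (V 0) (rnv Suc Suc \<circ> \<sigma>)"

lemma ux_simps [simp]: "ux \<sigma> 0 = V 0" "ux \<sigma> (Suc n) = rnv Suc id (\<sigma> n)"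
  by (simp_all add: ux_def)

lemma ub_simps [simp]: "ub \<sigma> 0 = V 0" "ub \<sigma> (Suc n) = rnv Suc Suc (\<sigma> n)"
  by (simp_all add: ub_def)

primrec vsv :: "(nat \<Rightarrow> val) \<Rightarrow> (nat \<Rightarrow> nat) \<Rightarrow> val \<Rightarrow> val"
    and vsj :: "(nat \<Rightarrow> val) \<Rightarrow> (nat \<Rightarrow> nat) \<Rightarrow> jmp \<Rightarrow> jmp" where
  "vsv \<sigma> \<zeta> (V i) = \<sigma> i"
| "vsv \<sigma> \<zeta> (Abs J) = Abs (vsj (ub \<sigma>) (up \<zeta>) J)"
| "vsj \<sigma> \<zeta> (Ret k W) = Ret (\<zeta> k) (vsv \<sigma> \<zeta> W)"
| "vsj \<sigma> \<zeta> (Call A B J) = Call (vsv \<sigma> \<zeta> A) (vsv \<sigma> \<zeta> B) (vsj (ux \<sigma>) \<zeta> J)"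

lemma ux_V [simp]: "ux (V \<circ> \<xi>) = V \<circ> up \<xi>" "ux V = V"
  by (auto simp: fun_eq_iff ux_def up_def split: nat.split)

lemma ub_V [simp]: "ub (V \<circ> \<xi>) = V \<circ> up \<xi>" "ub V = V"
  by (auto simp: fun_eq_iff ub_def up_def split: nat.split)

lemma rn_eq_vs: "rnv \<xi> \<zeta> W = vsv (V \<circ> \<xi>) \<zeta> W" "rnj \<xi> \<zeta> J = vsj (V \<circ> \<xi>) \<zeta> J"
  by (induction W and J arbitrary: \<xi> \<zeta> and \<xi> \<zeta>) simp_all

lemma vs_V [simp]: "vsv V \<zeta> W = rnv id \<zeta> W" "vsj V \<zeta> J = rnj id \<zeta> J"
  by (simp_all add: rn_eq_vs)

lemma ux_up [simp]: "ux \<sigma> \<circ> up \<xi> = ux (\<sigma> \<circ> \<xi>)"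
  by (auto simp: fun_eq_iff ux_def up_def split: nat.split)

lemma ub_up [simp]: "ub \<sigma> \<circ> up \<xi> = ub (\<sigma> \<circ> \<xi>)"
  by (auto simp: fun_eq_iff ub_def up_def split: nat.split)

lemma vs_rn [simp]:
  "vsv \<sigma> \<zeta> (rnv \<xi> \<zeta>' W) = vsv (\<sigma> \<circ> \<xi>) (\<zeta> \<circ> \<zeta>') W"
  "vsj \<sigma> \<zeta> (rnj \<xi> \<zeta>' J) = vsj (\<sigma> \<circ> \<xi>) (\<zeta> \<circ> \<zeta>') J"
  by (induction W and J arbitrary: \<sigma> \<zeta> \<xi> \<zeta>' and \<sigma> \<zeta> \<xi> \<zeta>') simp_all

lemma rn_ux [simp]: "rnv (up \<xi>) \<zeta> \<circ> ux \<sigma> = ux (rnv \<xi> \<zeta> \<circ> \<sigma>)"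
  by (auto simp: fun_eq_iff ux_def split: nat.split)

lemma rn_ub [simp]: "rnv (up \<xi>) (up \<zeta>) \<circ> ub \<sigma> = ub (rnv \<xi> \<zeta> \<circ> \<sigma>)"
  by (auto simp: fun_eq_iff ub_def split: nat.split)

lemma rn_vs [simp]:
  "rnv \<xi> \<zeta> (vsv \<sigma> \<zeta>' W) = vsv (rnv \<xi> \<zeta> \<circ> \<sigma>) (\<zeta> \<circ> \<zeta>') W"
  "rnj \<xi> \<zeta> (vsj \<sigma> \<zeta>' J) = vsj (rnv \<xi> \<zeta> \<circ> \<sigma>) (\<zeta> \<circ> \<zeta>') J"
  by (induction W and J arbitrary: \<sigma> \<zeta> \<xi> \<zeta>' and \<sigma> \<zeta> \<xi> \<zeta>') simp_all

lemma ux_Suc [simp]: "ux \<sigma> \<circ> Suc = rnv Suc id \<circ> \<sigma>"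
  by (auto simp: fun_eq_iff)
lemma ub_Suc [simp]: "ub \<sigma> \<circ> Suc = rnv Suc Suc \<circ> \<sigma>"
  by (auto simp: fun_eq_iff)

lemma vs_ux [simp]: "vsv (ux \<sigma>) \<zeta> \<circ> ux \<sigma>' = ux (vsv \<sigma> \<zeta> \<circ> \<sigma>')"
  by (auto simp: fun_eq_iff ux_def[of \<sigma>'] ux_def[of "_ \<circ> _"] split: nat.split)

lemma vs_ub [simp]: "vsv (ub \<sigma>) (up \<zeta>) \<circ> ub \<sigma>' = ub (vsv \<sigma> \<zeta> \<circ> \<sigma>')"
  by (auto simp: fun_eq_iff ub_def[of \<sigma>'] ub_def[of "_ \<circ> _"] split: nat.split)

lemma vs_vs [simp]:
  "vsv \<sigma> \<zeta> (vsv \<sigma>' \<zeta>' W) = vsv (vsv \<sigma> \<zeta> \<circ> \<sigma>') (\<zeta> \<circ> \<zeta>') W"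
  "vsj \<sigma> \<zeta> (vsj \<sigma>' \<zeta>' J) = vsj (vsv \<sigma> \<zeta> \<circ> \<sigma>') (\<zeta> \<circ> \<zeta>') J"
  by (induction W and J arbitrary: \<sigma> \<zeta> \<sigma>' \<zeta>' and \<sigma> \<zeta> \<sigma>' \<zeta>') simp_all

definition inst :: "val \<Rightarrow> jmp \<Rightarrow> jmp" where
  "inst W = vsj (case_nat W V) id"

text \<open>A jump standing for a continuation binds ordinary index 0, the value it receives.
  Weakening therefore uses \<open>up Suc\<close>, which leaves that index alone.\<close>

definition tx :: "(nat \<Rightarrow> jmp) \<Rightarrow> nat \<Rightarrow> jmp" where
  "tx \<tau> = rnj (up Suc) id \<circ> \<tau>"

definition tb :: "(nat \<Rightarrow> jmp) \<Rightarrow> nat \<Rightarrow> jmp" where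
  "tb \<tau> = case_nat (Ret 0 (V 0)) (rnj (up Suc) Suc \<circ> \<tau>)"

lemma tx_apply [simp]: "tx \<tau> k = rnj (up Suc) id (\<tau> k)"
  by (simp add: tx_def)

lemma tb_simps [simp]: "tb \<tau> 0 = Ret 0 (V 0)" "tb \<tau> (Suc k) = rnj (up Suc) Suc (\<tau> k)"
  by (simp_all add: tb_def)

text \<open>The \<open>Ret\<close> clause contracts the continuation redex at once. The recursion
  stays structural because \<open>inst\<close> only puts a value for a variable, which creates no
  further continuation redex. This is why \<open>vsj\<close> comes first, as a level of its
  own.\<close>

primrec sbv :: "(nat \<Rightarrow> val) \<Rightarrow> (nat \<Rightarrow> jmp) \<Rightarrow> val \<Rightarrow> val"
    and sbj :: "(nat \<Rightarrow> val) \<Rightarrow> (nat \<Rightarrow> jmp) \<Rightarrow> jmp \<Rightarrow> jmp" where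
  "sbv \<sigma> \<tau> (V i) = \<sigma> i"
| "sbv \<sigma> \<tau> (Abs J) = Abs (sbj (ub \<sigma>) (tb \<tau>) J)"
| "sbj \<sigma> \<tau> (Ret k W) = inst (sbv \<sigma> \<tau> W) (\<tau> k)"
| "sbj \<sigma> \<tau> (Call A B J) = Call (sbv \<sigma> \<tau> A) (sbv \<sigma> \<tau> B) (sbj (ux \<sigma>) (tx \<tau>) J)"

text \<open>The eta-expansion of continuation variable k. It acts as the identity substitution for
  k, since k occurs only in \<open>Ret\<close>.\<close>

definition kv :: "nat \<Rightarrow> jmp" where
  "kv k = Ret k (V 0)"

lemma inst_kv [simp]: "inst W (kv k) = Ret k W"
  by (simp add: inst_def kv_def)

lemma rn_kv [simp]: "rnj (up \<xi>) \<zeta> (kv k) = kv (\<zeta> k)"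
  by (simp add: kv_def)

lemma tx_kv [simp]: "tx (kv \<circ> \<zeta>) = kv \<circ> \<zeta>" "tx kv = kv"
  by (auto simp: fun_eq_iff)

lemma tb_kv [simp]: "tb (kv \<circ> \<zeta>) = kv \<circ> up \<zeta>" "tb kv = kv"
  by (auto simp: fun_eq_iff tb_def kv_def up_def split: nat.split)

lemma sb_kv [simp]:
  "sbv \<sigma> (kv \<circ> \<zeta>) W = vsv \<sigma> \<zeta> W" "sbj \<sigma> (kv \<circ> \<zeta>) J = vsj \<sigma> \<zeta> J"
  by (induction W and J arbitrary: \<sigma> \<zeta> and \<sigma> \<zeta>) simp_all

lemma sb_kv_id [simp]: "sbv \<sigma> kv W = vsv \<sigma> id W" "sbj \<sigma> kv J = vsj \<sigma> id J"
  using sb_kv[of \<sigma> id] by simp_all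

lemma tb_up [simp]: "tb \<tau> \<circ> up \<zeta> = tb (\<tau> \<circ> \<zeta>)"
  by (auto simp: fun_eq_iff tb_def up_def split: nat.split)

lemma tx_comp [simp]: "tx \<tau> \<circ> \<zeta> = tx (\<tau> \<circ> \<zeta>)"
  by (auto simp: fun_eq_iff)

lemma sb_rn [simp]:
  "sbv \<sigma> \<tau> (rnv \<xi> \<zeta> W) = sbv (\<sigma> \<circ> \<xi>) (\<tau> \<circ> \<zeta>) W"
  "sbj \<sigma> \<tau> (rnj \<xi> \<zeta> J) = sbj (\<sigma> \<circ> \<xi>) (\<tau> \<circ> \<zeta>) J"
  by (induction W and J arbitrary: \<sigma> \<tau> \<xi> \<zeta> and \<sigma> \<tau> \<xi> \<zeta>) simp_all

lemma comp_case_nat: "f \<circ> case_nat a g = case_nat (f a) (f \<circ> g)"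
  by (auto simp: fun_eq_iff split: nat.split)

lemma case_nat_up: "case_nat a g \<circ> up f = case_nat a (g \<circ> f)"
  by (auto simp: fun_eq_iff up_def split: nat.split)

lemma case_nat_Suc [simp]: "case_nat a g \<circ> Suc = g"
  by (auto simp: fun_eq_iff)

lemma rnv_comp_V [simp]: "rnv \<xi> \<zeta> \<circ> V = V \<circ> \<xi>"
  by (auto simp: fun_eq_iff)

lemma vsv_comp_V [simp]: "vsv \<sigma> \<zeta> \<circ> V = \<sigma>"
  by (auto simp: fun_eq_iff)

lemma sbv_comp_V [simp]: "sbv \<sigma> \<tau> \<circ> V = \<sigma>"
  by (auto simp: fun_eq_iff)

lemma rn_inst: "rnj \<xi> \<zeta> (inst W J) = inst (rnv \<xi> \<zeta> W) (rnj (up \<xi>) \<zeta> J)"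
  by (simp add: inst_def comp_case_nat case_nat_up)

lemma rn_tx: "rnj (up (up \<xi>)) \<zeta> \<circ> tx \<tau> = tx (rnj (up \<xi>) \<zeta> \<circ> \<tau>)"
  by (auto simp: fun_eq_iff)

lemma rn_tb: "rnj (up (up \<xi>)) (up \<zeta>) \<circ> tb \<tau> = tb (rnj (up \<xi>) \<zeta> \<circ> \<tau>)"
  by (auto simp: fun_eq_iff tb_def split: nat.split)

lemma rn_sb [simp]:
  "rnv \<xi> \<zeta> (sbv \<sigma> \<tau> W) = sbv (rnv \<xi> \<zeta> \<circ> \<sigma>) (rnj (up \<xi>) \<zeta> \<circ> \<tau>) W"
  "rnj \<xi> \<zeta> (sbj \<sigma> \<tau> J) = sbj (rnv \<xi> \<zeta> \<circ> \<sigma>) (rnj (up \<xi>) \<zeta> \<circ> \<tau>) J"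
  by (induction W and J arbitrary: \<sigma> \<tau> \<xi> \<zeta> and \<sigma> \<tau> \<xi> \<zeta>)
     (simp_all add: rn_inst rn_tx rn_tb)

lemma case_nat_ux: "vsv (case_nat W V) id \<circ> ux \<sigma> = case_nat W \<sigma>"
  by (auto simp: fun_eq_iff ux_def split: nat.split)

lemma vs_inst: "vsj \<sigma> \<zeta> (inst W J) = inst (vsv \<sigma> \<zeta> W) (vsj (ux \<sigma>) \<zeta> J)"
  by (simp add: inst_def comp_case_nat case_nat_ux)

lemma vs_tx: "vsj (ux (ux \<sigma>)) \<zeta> \<circ> tx \<tau> = tx (vsj (ux \<sigma>) \<zeta> \<circ> \<tau>)"
  by (auto simp: fun_eq_iff)

lemma ux_ub_up_Suc: "ux (ub \<sigma>) \<circ> up Suc = rnv (up Suc) Suc \<circ> ux \<sigma>"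
  by (auto simp: fun_eq_iff ux_def ub_def up_def split: nat.split)

lemma vs_tb: "vsj (ux (ub \<sigma>)) (up \<zeta>) \<circ> tb \<tau> = tb (vsj (ux \<sigma>) \<zeta> \<circ> \<tau>)"
  by (auto simp: fun_eq_iff tb_def split: nat.split)

lemma vs_sb [simp]:
  "vsv \<sigma> \<zeta> (sbv \<sigma>' \<tau> W) = sbv (vsv \<sigma> \<zeta> \<circ> \<sigma>') (vsj (ux \<sigma>) \<zeta> \<circ> \<tau>) W"
  "vsj \<sigma> \<zeta> (sbj \<sigma>' \<tau> J) = sbj (vsv \<sigma> \<zeta> \<circ> \<sigma>') (vsj (ux \<sigma>) \<zeta> \<circ> \<tau>) J"
  by (induction W and J arbitrary: \<sigma> \<sigma>' \<tau> \<zeta> and \<sigma> \<sigma>' \<tau> \<zeta>)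
     (simp_all add: vs_inst vs_tx vs_tb)

lemma sb_ux [simp]: "sbv (ux \<sigma>) (tx \<tau>) \<circ> ux \<sigma>' = ux (sbv \<sigma> \<tau> \<circ> \<sigma>')"
  by (auto simp: fun_eq_iff ux_def[of \<sigma>'] ux_def[of "_ \<circ> _"] tx_def split: nat.split)

lemma tb_Suc [simp]: "tb \<tau> \<circ> Suc = rnj (up Suc) Suc \<circ> \<tau>"
  by (auto simp: fun_eq_iff)

lemma sb_ub [simp]: "sbv (ub \<sigma>) (tb \<tau>) \<circ> ub \<sigma>' = ub (sbv \<sigma> \<tau> \<circ> \<sigma>')"
  by (auto simp: fun_eq_iff ub_def[of \<sigma>'] ub_def[of "_ \<circ> _"] split: nat.split)

lemma sb_vs [simp]:
  "sbv \<sigma> \<tau> (vsv \<sigma>' \<zeta> W) = sbv (sbv \<sigma> \<tau> \<circ> \<sigma>') (\<tau> \<circ> \<zeta>) W"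
  "sbj \<sigma> \<tau> (vsj \<sigma>' \<zeta> J) = sbj (sbv \<sigma> \<tau> \<circ> \<sigma>') (\<tau> \<circ> \<zeta>) J"
  by (induction W and J arbitrary: \<sigma> \<tau> \<sigma>' \<zeta> and \<sigma> \<tau> \<sigma>' \<zeta>) simp_all

lemma rnj_comp_rnj: "rnj \<xi> \<zeta> \<circ> (rnj \<xi>' \<zeta>' \<circ> \<tau>) = rnj (\<xi> \<circ> \<xi>') (\<zeta> \<circ> \<zeta>') \<circ> \<tau>"
  by (simp add: fun_eq_iff)

lemma sb_inst: "sbj \<sigma> \<tau> (inst W J) = inst (sbv \<sigma> \<tau> W) (sbj (ux \<sigma>) (tx \<tau>) J)"
proof -
  \<comment> \<open>\<open>tx\<close> weakens past the index that receives the value, so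
    instantiating that index undoes it.\<close>
  have "vsj (ux (case_nat (sbv \<sigma> \<tau> W) V)) id \<circ> tx \<tau> = \<tau>"
    by (auto simp: fun_eq_iff case_nat_Suc)
  thus ?thesis
    by (simp add: inst_def comp_case_nat case_nat_ux)
qed

lemma sb_tx: "sbj (ux (ux \<sigma>)) (tx (tx \<tau>)) \<circ> tx \<tau>' = tx (sbj (ux \<sigma>) (tx \<tau>) \<circ> \<tau>')"
  by (auto simp: fun_eq_iff tx_def comp_assoc rnj_comp_rnj)

lemma sb_tb: "sbj (ux (ub \<sigma>)) (tx (tb \<tau>)) \<circ> tb \<tau>' = tb (sbj (ux \<sigma>) (tx \<tau>) \<circ> \<tau>')"
  by (auto simp: fun_eq_iff tb_def tx_def comp_assoc rnj_comp_rnj inst_def split: nat.split)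

lemma sb_sb [simp]:
  "sbv \<sigma> \<tau> (sbv \<sigma>' \<tau>' W) = sbv (sbv \<sigma> \<tau> \<circ> \<sigma>') (sbj (ux \<sigma>) (tx \<tau>) \<circ> \<tau>') W"
  "sbj \<sigma> \<tau> (sbj \<sigma>' \<tau>' J) = sbj (sbv \<sigma> \<tau> \<circ> \<sigma>') (sbj (ux \<sigma>) (tx \<tau>) \<circ> \<tau>') J"
  by (induction W and J arbitrary: \<sigma> \<sigma>' \<tau> \<tau>' and \<sigma> \<sigma>' \<tau> \<tau>')
     (simp_all add: sb_inst sb_tx sb_tb)

section \<open>Parallel reduction\<close>

text \<open>In \<open>par_eta\<close>, W lives outside the double binder, whence
  \<open>rnv Suc Suc\<close>, and \<open>kv 0\<close> is the bound continuation. Eta overlaps with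
  beta in two ways: the body of its redex may be a beta redex, and the redex may be the function of
  a call.\<close>

inductive parv :: "val \<Rightarrow> val \<Rightarrow> bool" and parj :: "jmp \<Rightarrow> jmp \<Rightarrow> bool" where
  par_V: "parv (V i) (V i)"
| par_Abs: "parj J J' \<Longrightarrow> parv (Abs J) (Abs J')"
| par_eta: "parv W W' \<Longrightarrow> parv (Abs (Call (rnv Suc Suc W) (V 0) (kv 0))) W'"
| par_Ret: "parv W W' \<Longrightarrow> parj (Ret k W) (Ret k W')"
| par_Call: "parv A A' \<Longrightarrow> parv B B' \<Longrightarrow> parj J J' \<Longrightarrow> parj (Call A B J) (Call A' B' J')"
| par_beta: "parj J J' \<Longrightarrow> parv B B' \<Longrightarrow> parj K K' \<Longrightarrow>
    parj (Call (Abs J) B K) (sbj (case_nat B' V) (case_nat K' kv) J')"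

inductive_cases parv_VE: "parv (V i) W"
inductive_cases parv_AbsE [consumes 1, case_names 1 2]: "parv (Abs J) W"
inductive_cases parj_RetE: "parj (Ret k W) J"
inductive_cases parj_CallE [consumes 1, case_names 1 2]: "parj (Call A B J) J'"

lemma par_refl: "parv W W" "parj J J"
  by (induction W and J) (auto intro: parv_parj.intros)

lemma vs_kv [simp]: "vsj (ux \<sigma>) \<zeta> (kv k) = kv (\<zeta> k)"
  by (simp add: kv_def)

lemma sb_kv_tx [simp]: "sbj (ux \<sigma>) (tx \<tau>) (kv k) = \<tau> k"
proof -
  have "case_nat (V 0) V \<circ> up Suc = V"
    by (auto simp: fun_eq_iff up_def split: nat.split)
  thus ?thesis by (simp add: kv_def inst_def)
qed

lemma comp_kv [simp]: "rnj (up \<xi>) \<zeta> \<circ> kv = kv \<circ> \<zeta>" "vsj (ux \<sigma>) \<zeta> \<circ> kv = kv \<circ> \<zeta>"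
  "sbj (ux \<sigma>) (tx \<tau>) \<circ> kv = \<tau>"
  by (simp_all add: fun_eq_iff)

lemma rn_beta:
  "rnj \<xi> \<zeta> (sbj (case_nat B V) (case_nat K kv) J) =
   sbj (case_nat (rnv \<xi> \<zeta> B) V) (case_nat (rnj (up \<xi>) \<zeta> K) kv) (rnj (up \<xi>) (up \<zeta>) J)"
  by (simp add: comp_case_nat case_nat_up)

lemma case_nat_ub: "sbv (case_nat W V) (case_nat K kv) \<circ> ub \<sigma> = case_nat W \<sigma>"
  by (auto simp: fun_eq_iff ub_def split: nat.split)

lemma sb_case_tx_tb:
  "sbj (ux (case_nat B V)) (tx (case_nat K kv)) \<circ> tb \<tau> = case_nat K \<tau>"
proof -
  have "tx (case_nat K kv) \<circ> Suc = kv"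
    by (simp add: fun_eq_iff)
  hence "sbj (ux (case_nat B V)) (tx (case_nat K kv)) (rnj (up Suc) Suc J) = J" for J
    by simp
  moreover have "sbj (ux (case_nat B V)) (tx (case_nat K kv)) (Ret 0 (V 0)) = K"
    using sb_kv_tx[of _ "case_nat K kv" 0] by (simp add: kv_def)
  ultimately show ?thesis
    by (auto simp: fun_eq_iff tb_def split: nat.split)
qed

lemma sb_beta:
  "sbj \<sigma> \<tau> (sbj (case_nat B V) (case_nat K kv) J) =
   sbj (case_nat (sbv \<sigma> \<tau> B) V) (case_nat (sbj (ux \<sigma>) (tx \<tau>) K) kv) (sbj (ub \<sigma>) (tb \<tau>) J)"
  by (simp add: comp_case_nat case_nat_ub sb_case_tx_tb)

lemma vs_beta:
  "vsj \<sigma> \<zeta> (sbj (case_nat B V) (case_nat K kv) J) =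
   sbj (case_nat (vsv \<sigma> \<zeta> B) V) (case_nat (vsj (ux \<sigma>) \<zeta> K) kv) (vsj (ub \<sigma>) (up \<zeta>) J)"
  by (simp add: comp_case_nat case_nat_up case_nat_ub)

lemma par_rn:
  "parv W W' \<Longrightarrow> parv (rnv \<xi> \<zeta> W) (rnv \<xi> \<zeta> W')"
  "parj J J' \<Longrightarrow> parj (rnj \<xi> \<zeta> J) (rnj \<xi> \<zeta> J')"
proof (induction arbitrary: \<xi> \<zeta> and \<xi> \<zeta> rule: parv_parj.inducts)
  case (par_eta W W')
  show ?case using parv_parj.par_eta[OF par_eta.IH[of \<xi> \<zeta>]] by (simp add: kv_def)
next
  case (par_beta J J' B B' K K')
  show ?case
    unfolding rn_beta using parv_parj.par_beta[OF par_beta.IH] by simp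
qed (auto intro: parv_parj.intros)

lemma par_ux: "(\<And>i. parv (\<sigma> i) (\<sigma>' i)) \<Longrightarrow> parv (ux \<sigma> i) (ux \<sigma>' i)"
  by (cases i) (auto intro: par_refl par_rn)

lemma par_ub: "(\<And>i. parv (\<sigma> i) (\<sigma>' i)) \<Longrightarrow> parv (ub \<sigma> i) (ub \<sigma>' i)"
  by (cases i) (auto intro: par_refl par_rn)

lemma par_vs:
  "parv W W' \<Longrightarrow> (\<And>i. parv (\<sigma> i) (\<sigma>' i)) \<Longrightarrow> parv (vsv \<sigma> \<zeta> W) (vsv \<sigma>' \<zeta> W')"
  "parj J J' \<Longrightarrow> (\<And>i. parv (\<sigma> i) (\<sigma>' i)) \<Longrightarrow> parj (vsj \<sigma> \<zeta> J) (vsj \<sigma>' \<zeta> J')"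
proof (induction arbitrary: \<sigma> \<sigma>' \<zeta> and \<sigma> \<sigma>' \<zeta> rule: parv_parj.inducts)
  case (par_eta W W')
  show ?case using parv_parj.par_eta[OF par_eta.IH[of \<sigma> \<sigma>' \<zeta>, OF par_eta.prems]] by (simp add: kv_def)
next
  case (par_beta J J' B B' K K')
  show ?case
    unfolding vs_beta
    using parv_parj.par_beta[OF par_beta.IH(1)[OF par_ub] par_beta.IH(2) par_beta.IH(3)[OF par_ux]]
      par_beta.prems by simp
next
  case (par_Abs J J')
  show ?case by (simp, intro parv_parj.intros par_Abs.IH par_ub par_Abs.prems)
next
  case (par_Call A A' B B' J J')
  show ?case by (simp, intro parv_parj.intros par_Call.IH par_ux par_Call.prems)
qed (auto intro: parv_parj.intros)

lemma par_inst: "parv W W' \<Longrightarrow> parj J J' \<Longrightarrow> parj (inst W J) (inst W' J')"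
  unfolding inst_def by (rule par_vs) (auto split: nat.split intro: par_refl)

lemma par_tx: "(\<And>i. parj (\<tau> i) (\<tau>' i)) \<Longrightarrow> parj (tx \<tau> i) (tx \<tau>' i)"
  by (auto intro: par_refl par_rn)

lemma par_tb: "(\<And>i. parj (\<tau> i) (\<tau>' i)) \<Longrightarrow> parj (tb \<tau> i) (tb \<tau>' i)"
  by (cases i) (auto intro: par_refl par_rn)

lemma par_sb:
  "parv W W' \<Longrightarrow> (\<And>i. parv (\<sigma> i) (\<sigma>' i)) \<Longrightarrow> (\<And>k. parj (\<tau> k) (\<tau>' k)) \<Longrightarrow>
    parv (sbv \<sigma> \<tau> W) (sbv \<sigma>' \<tau>' W')"
  "parj J J' \<Longrightarrow> (\<And>i. parv (\<sigma> i) (\<sigma>' i)) \<Longrightarrow> (\<And>k. parj (\<tau> k) (\<tau>' k)) \<Longrightarrow>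
    parj (sbj \<sigma> \<tau> J) (sbj \<sigma>' \<tau>' J')"
proof (induction arbitrary: \<sigma> \<sigma>' \<tau> \<tau>' and \<sigma> \<sigma>' \<tau> \<tau>' rule: parv_parj.inducts)
  case (par_eta W W')
  have *: "sbj (ux (ub \<sigma>)) (tx (tb \<tau>)) (kv 0) = kv 0"
    by (simp add: kv_def inst_def)
  have "parv (sbv \<sigma> \<tau> W) (sbv \<sigma>' \<tau>' W')" by (intro par_eta.IH par_eta.prems)
  from parv_parj.par_eta[OF this] show ?case by (simp add: kv_def inst_def)
next
  case (par_beta J J' B B' K K')
  show ?case
    unfolding sb_beta sbj.simps sbv.simps
    by (intro parv_parj.par_beta par_beta.IH par_ub par_tb par_ux par_tx par_beta.prems)
next
  case (par_Call A A' B B' J J')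
  show ?case by (simp, intro parv_parj.intros par_Call.IH par_ux par_tx par_Call.prems)
next
  case (par_Abs J J')
  show ?case by (simp, intro parv_parj.intros par_Abs.IH par_ub par_tb par_Abs.prems)
qed (auto intro: parv_parj.intros par_inst)

section \<open>Reflecting parallel reduction along renamings\<close>

definition pullback :: "(nat \<Rightarrow> nat) \<Rightarrow> (nat \<Rightarrow> nat) \<Rightarrow> (nat \<Rightarrow> nat) \<Rightarrow> (nat \<Rightarrow> nat) \<Rightarrow> bool" where
  "pullback f g f' g' \<longleftrightarrow> (\<forall>i j. f i = g j \<longrightarrow> (\<exists>m. i = g' m \<and> j = f' m))"

lemma pullback_up: "pullback f g f' g' \<Longrightarrow> pullback (up f) (up g) (up f') (up g')"
  unfolding pullback_def
proof (intro allI impI)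
  fix i j assume *: "\<forall>i j. f i = g j \<longrightarrow> (\<exists>m. i = g' m \<and> j = f' m)" "up f i = up g j"
  show "\<exists>m. i = up g' m \<and> j = up f' m"
  proof (cases i)
    case 0
    with * show ?thesis by (cases j) (auto intro: exI[of _ 0])
  next
    case (Suc i')
    with * obtain j' where "j = Suc j'" "f i' = g j'" by (cases j) auto
    with * Suc obtain m where "i' = g' m" "j' = f' m" by blast
    with Suc \<open>j = Suc j'\<close> show ?thesis by (intro exI[of _ "Suc m"]) simp
  qed
qed

lemma pullback_up_Suc: "pullback (up f) Suc f Suc"
  unfolding pullback_def by (intro allI impI, case_tac i) auto

text \<open>\<open>pullback\<close> is the existence half of the universal property, which passes
  from indices to expressions. With \<open>pullback_up_Suc\<close> it shows that if a renaming taken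
  under a double binder avoids the bound variables, then so did the original.\<close>

lemma rn_pullback:
  "rnv \<xi> \<zeta> W = rnv \<xi>' \<zeta>' U \<Longrightarrow> pullback \<xi> \<xi>' \<theta> \<theta>' \<Longrightarrow> pullback \<zeta> \<zeta>' \<eta> \<eta>' \<Longrightarrow>
    \<exists>X. W = rnv \<theta>' \<eta>' X \<and> U = rnv \<theta> \<eta> X"
  "rnj \<xi> \<zeta> J = rnj \<xi>' \<zeta>' L \<Longrightarrow> pullback \<xi> \<xi>' \<theta> \<theta>' \<Longrightarrow> pullback \<zeta> \<zeta>' \<eta> \<eta>' \<Longrightarrow>
    \<exists>X. J = rnj \<theta>' \<eta>' X \<and> L = rnj \<theta> \<eta> X"
proof (induction W and J arbitrary: U \<xi> \<zeta> \<xi>' \<zeta>' \<theta> \<theta>' \<eta> \<eta>' and L \<xi> \<zeta> \<xi>' \<zeta>' \<theta> \<theta>' \<eta> \<eta>')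
  case (V i)
  from V.prems(1) obtain j where "U = V j" "\<xi> i = \<xi>' j" by (cases U) auto
  with V.prems(2) show ?case unfolding pullback_def by (metis rnv.simps(1))
next
  case (Abs J)
  from Abs.prems(1) obtain L where "U = Abs L" "rnj (up \<xi>) (up \<zeta>) J = rnj (up \<xi>') (up \<zeta>') L"
    by (cases U) auto
  with Abs.IH Abs.prems(2,3) pullback_up obtain X
    where "J = rnj (up \<theta>') (up \<eta>') X" "L = rnj (up \<theta>) (up \<eta>) X" by metis
  with \<open>U = Abs L\<close> show ?case by (intro exI[of _ "Abs X"]) simp
next
  case (Ret k W)
  from Ret.prems(1) obtain l U where "L = Ret l U" "rnv \<xi> \<zeta> W = rnv \<xi>' \<zeta>' U" "\<zeta> k = \<zeta>' l"
    by (cases L) auto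
  moreover with Ret.IH Ret.prems(2,3) obtain X
    where "W = rnv \<theta>' \<eta>' X" "U = rnv \<theta> \<eta> X" by metis
  moreover from \<open>\<zeta> k = \<zeta>' l\<close> obtain m where "k = \<eta>' m" "l = \<eta> m"
    using Ret.prems(3) unfolding pullback_def by blast
  ultimately show ?case by (intro exI[of _ "Ret m X"]) simp
next
  case (Call A B J)
  from Call.prems(1) obtain A' B' L' where L: "L = Call A' B' L'" "rnv \<xi> \<zeta> A = rnv \<xi>' \<zeta>' A'"
    "rnv \<xi> \<zeta> B = rnv \<xi>' \<zeta>' B'" "rnj (up \<xi>) \<zeta> J = rnj (up \<xi>') \<zeta>' L'"
    by (cases L) auto
  obtain X where "A = rnv \<theta>' \<eta>' X" "A' = rnv \<theta> \<eta> X"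
    using Call.IH(1)[OF L(2) Call.prems(2,3)] by blast
  moreover obtain Y where "B = rnv \<theta>' \<eta>' Y" "B' = rnv \<theta> \<eta> Y"
    using Call.IH(2)[OF L(3) Call.prems(2,3)] by blast
  moreover obtain Z where "J = rnj (up \<theta>') \<eta>' Z" "L' = rnj (up \<theta>) \<eta> Z"
    using Call.IH(3)[OF L(4) pullback_up[OF Call.prems(2)] Call.prems(3)] by blast
  ultimately show ?case using L(1) by (intro exI[of _ "Call X Y Z"]) simp
qed

lemma rn_eqD:
  "rnv \<xi> \<zeta> W = Abs J' \<Longrightarrow> \<exists>J. W = Abs J \<and> J' = rnj (up \<xi>) (up \<zeta>) J"
  "rnv \<xi> \<zeta> W = V i \<Longrightarrow> \<exists>j. W = V j \<and> \<xi> j = i"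
  "rnj \<xi> \<zeta> J = Ret k U \<Longrightarrow> \<exists>l W. J = Ret l W \<and> \<zeta> l = k \<and> U = rnv \<xi> \<zeta> W"
  "rnj \<xi> \<zeta> J = Call A B K \<Longrightarrow> \<exists>A' B' K'. J = Call A' B' K' \<and> A = rnv \<xi> \<zeta> A' \<and> B = rnv \<xi> \<zeta> B' \<and>
     K = rnj (up \<xi>) \<zeta> K'"
  by (cases W; auto)+ (cases J; auto)+

lemma up_eq_0 [simp]: "up f i = 0 \<longleftrightarrow> i = 0" "0 = up f i \<longleftrightarrow> i = 0"
  by (cases i; simp)+

text \<open>Renaming creates no redex, injective or not: the only side condition is the freshness in
  eta, and \<open>rn_pullback\<close> reflects it. The instance with \<open>Suc\<close> and
  \<open>Suc\<close> serves \<open>par_eta_body\<close>.\<close>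

lemma par_rn_inv:
  "parv X Y \<Longrightarrow> X = rnv \<xi> \<zeta> W \<Longrightarrow> \<exists>W'. Y = rnv \<xi> \<zeta> W' \<and> parv W W'"
  "parj P Q \<Longrightarrow> P = rnj \<xi> \<zeta> J \<Longrightarrow> \<exists>J'. Q = rnj \<xi> \<zeta> J' \<and> parj J J'"
proof (induction arbitrary: \<xi> \<zeta> W and \<xi> \<zeta> J rule: parv_parj.inducts)
  case (par_V i)
  then show ?case by (metis par_refl(1))
next
  case (par_Abs J J')
  then obtain L where "W = Abs L" "J = rnj (up \<xi>) (up \<zeta>) L" by (metis rn_eqD(1))
  with par_Abs.IH obtain L' where "J' = rnj (up \<xi>) (up \<zeta>) L'" "parj L L'" by blast
  with \<open>W = Abs L\<close> show ?case by (intro exI[of _ "Abs L'"]) (simp add: parv_parj.par_Abs)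
next
  case (par_eta U U')
  from par_eta.prems[symmetric] obtain L where W: "W = Abs L"
    "Call (rnv Suc Suc U) (V 0) (kv 0) = rnj (up \<xi>) (up \<zeta>) L"
    by (metis rn_eqD(1))
  from rn_eqD(4)[OF W(2)[symmetric]] obtain A B K where
    L: "L = Call A B K" "rnv Suc Suc U = rnv (up \<xi>) (up \<zeta>) A" "V 0 = rnv (up \<xi>) (up \<zeta>) B"
       "kv 0 = rnj (up (up \<xi>)) (up \<zeta>) K" by blast
  from L(3) have B: "B = V 0" by (cases B) auto
  from L(4) have K: "K = kv 0"
    by (auto simp: kv_def dest!: sym[of "Ret _ _"] rn_eqD(3)) (metis rn_eqD(2) up_eq_0(1))
  obtain X where X: "A = rnv Suc Suc X" "U = rnv \<xi> \<zeta> X"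
    using rn_pullback(1)[OF L(2)[symmetric] pullback_up_Suc pullback_up_Suc] by blast
  from par_eta.IH[OF X(2)] obtain W' where "U' = rnv \<xi> \<zeta> W'" "parv X W'" by blast
  moreover have "W = Abs (Call (rnv Suc Suc X) (V 0) (kv 0))" unfolding W(1) L(1) B K X(1) by (rule refl)
  ultimately show ?case using parv_parj.par_eta[of X W'] by (intro exI[of _ W']) simp
next
  case (par_Ret U U' k)
  then obtain l X where "J = Ret l X" "\<zeta> l = k" "U = rnv \<xi> \<zeta> X" by (metis rn_eqD(3))
  with par_Ret.IH obtain X' where "U' = rnv \<xi> \<zeta> X'" "parv X X'" by blast
  with \<open>J = Ret l X\<close> \<open>\<zeta> l = k\<close> show ?case
    by (intro exI[of _ "Ret l X'"]) (simp add: parv_parj.par_Ret)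
next
  case (par_Call A A' B B' K K')
  from rn_eqD(4)[OF par_Call.prems[symmetric]] obtain A1 B1 K1 where
    J: "J = Call A1 B1 K1" and eq: "A = rnv \<xi> \<zeta> A1" "B = rnv \<xi> \<zeta> B1" "K = rnj (up \<xi>) \<zeta> K1" by blast
  from par_Call.IH(1)[OF eq(1)] par_Call.IH(2)[OF eq(2)] par_Call.IH(3)[OF eq(3)]
  obtain A2 B2 K2 where "A' = rnv \<xi> \<zeta> A2" "B' = rnv \<xi> \<zeta> B2" "K' = rnj (up \<xi>) \<zeta> K2"
    "parv A1 A2" "parv B1 B2" "parj K1 K2" by blast
  with J show ?case by (intro exI[of _ "Call A2 B2 K2"]) (simp add: parv_parj.par_Call)
next
  case (par_beta L L' B B' K K')
  from rn_eqD(4)[OF par_beta.prems[symmetric]] obtain A1 B1 K1 where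
    J: "J = Call A1 B1 K1" and eq: "Abs L = rnv \<xi> \<zeta> A1" "B = rnv \<xi> \<zeta> B1" "K = rnj (up \<xi>) \<zeta> K1" by blast
  from rn_eqD(1)[OF eq(1)[symmetric]] obtain L1 where
    A1: "A1 = Abs L1" "L = rnj (up \<xi>) (up \<zeta>) L1" by blast
  from par_beta.IH(1)[OF A1(2)] par_beta.IH(2)[OF eq(2)] par_beta.IH(3)[OF eq(3)]
  obtain L2 B2 K2 where L2: "L' = rnj (up \<xi>) (up \<zeta>) L2" "B' = rnv \<xi> \<zeta> B2" "K' = rnj (up \<xi>) \<zeta> K2"
    "parj L1 L2" "parv B1 B2" "parj K1 K2" by blast
  show ?case
    unfolding J A1(1) L2(1-3) rn_beta[symmetric] using parv_parj.par_beta[OF L2(4-6)] by blast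
qed

lemma size_rn [simp]: "size (rnv \<xi> \<zeta> W) = size W" "size (rnj \<xi> \<zeta> J) = size J"
  by (induction W and J arbitrary: \<xi> \<zeta> and \<xi> \<zeta>) simp_all

lemma parj_kvD: "parj (kv k) J \<Longrightarrow> J = kv k"
  unfolding kv_def by (auto elim!: parj_RetE parv_VE)

lemma beta_V0: "sbj (case_nat (V 0) V) (case_nat (kv 0) kv) (rnj (up Suc) (up Suc) J) = J"
proof -
  have "case_nat (V 0) V \<circ> up Suc = V" "case_nat (kv 0) kv \<circ> up Suc = kv"
    by (auto simp: fun_eq_iff up_def split: nat.split)
  thus ?thesis by simp
qed

text \<open>The second alternative is the overlap of eta with a beta step in its body: in \<lambda>x
  k. (\<lambda>x k. L) x k the inner beta step merely undoes the weakening, so it agrees with the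
  eta step up to the reductions made inside L.\<close>

lemma par_eta_body:
  assumes "parj (Call (rnv Suc Suc W) (V 0) (kv 0)) J"
  shows "(\<exists>W'. J = Call (rnv Suc Suc W') (V 0) (kv 0) \<and> parv W W') \<or>
         (\<exists>L. W = Abs L \<and> parj L J)"
  using assms
proof (cases rule: parj_CallE)
  case (1 A' B' J')
  then show ?thesis using par_rn_inv(1)[OF 1(2) refl] by (auto elim!: parv_VE dest!: parj_kvD)
next
  case (2 L L' B' K')
  from 2(1) obtain L0 where L0: "W = Abs L0" "L = rnj (up Suc) (up Suc) L0"
    using rn_eqD(1)[of Suc Suc W L] by metis
  from par_rn_inv(2)[OF 2(3) L0(2)] obtain L1 where L1: "L' = rnj (up Suc) (up Suc) L1" "parj L0 L1"
    by blast
  have "J = L1" using 2 L1(1) by (auto elim!: parv_VE dest!: parj_kvD simp del: sb_rn simp: beta_V0)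
  with L0 L1 show ?thesis by blast
qed

lemma beta_eta_body:
  "sbj (case_nat B V) (case_nat K kv) (Call (rnv Suc Suc W) (V 0) (kv 0)) = Call W B K"
  by simp

lemma rnv_Suc_inj: "rnv Suc Suc W = rnv Suc Suc W' \<longleftrightarrow> W = W'"
proof
  assume "rnv Suc Suc W = rnv Suc Suc W'"
  hence "rnv (\<lambda>n. n - 1) (\<lambda>n. n - 1) (rnv Suc Suc W) = rnv (\<lambda>n. n - 1) (\<lambda>n. n - 1) (rnv Suc Suc W')" by simp
  moreover have "(\<lambda>n. n - 1) \<circ> Suc = id" by auto
  ultimately show "W = W'" by simp
qed simp

text \<open>The induction is on a size bound because an eta redex contracts to a value of which only
  a renamed copy is a subterm, and because the jump \<open>Call U B K\<close> used below is no
  subterm at all.\<close>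

lemma par_diamond:
  "size W < n \<Longrightarrow> parv W W1 \<Longrightarrow> parv W W2 \<Longrightarrow> \<exists>W3. parv W1 W3 \<and> parv W2 W3"
  "size J < n \<Longrightarrow> parj J J1 \<Longrightarrow> parj J J2 \<Longrightarrow> \<exists>J3. parj J1 J3 \<and> parj J2 J3"
proof (induction n arbitrary: W W1 W2 J J1 J2)
  case (Suc n)
  have eta_Abs: "\<exists>W3. parv U' W3 \<and> parv (Abs L) W3"
    if U: "size U + 1 < n" "parv U U'" "parj (Call (rnv Suc Suc U) (V 0) (kv 0)) L" for U U' L
    using par_eta_body[OF U(3)]
  proof
    assume "\<exists>W'. L = Call (rnv Suc Suc W') (V 0) (kv 0) \<and> parv U W'"
    then obtain W' where W': "L = Call (rnv Suc Suc W') (V 0) (kv 0)" "parv U W'" by blast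
    with Suc.IH(1)[OF _ U(2) W'(2)] U(1) show ?thesis by (auto intro: par_eta)
  next
    assume "\<exists>M. U = Abs M \<and> parj M L"
    with Suc.IH(1)[OF _ U(2), of "Abs L"] U(1) show ?thesis by (auto intro: par_Abs)
  qed
  have beta_Call: "\<exists>J3. parj (Call A' B1 K1) J3 \<and> parj (sbj (case_nat B2 V) (case_nat K2 kv) L2) J3"
    if h: "size (Call (Abs L) B K) < Suc n" "parv (Abs L) A'" "parv B B1" "parj K K1"
      "parj L L2" "parv B B2" "parj K K2" for L B K A' B1 K1 L2 B2 K2
  proof -
    obtain B3 where B3: "parv B1 B3" "parv B2 B3" using Suc.IH(1)[OF _ h(3,6)] h(1) by auto
    obtain K3 where K3: "parj K1 K3" "parj K2 K3" using Suc.IH(2)[OF _ h(4,7)] h(1) by auto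
    from h(2) show ?thesis
    proof (cases rule: parv_AbsE)
      case (1 L1)
      obtain L3 where L3: "parj L1 L3" "parj L2 L3" using Suc.IH(2)[OF _ 1(2) h(5)] h(1) by auto
      have "parj (sbj (case_nat B2 V) (case_nat K2 kv) L2) (sbj (case_nat B3 V) (case_nat K3 kv) L3)"
        by (rule par_sb) (auto split: nat.split intro: L3 B3 K3 par_refl)
      with 1(1) par_beta[OF L3(1) B3(1) K3(1)] show ?thesis by blast
    next
      case (2 U)
      from par_eta_body[OF h(5)[unfolded 2(1)]] show ?thesis
      proof
        assume "\<exists>W'. L2 = Call (rnv Suc Suc W') (V 0) (kv 0) \<and> parv U W'"
        then obtain W' where W': "L2 = Call (rnv Suc Suc W') (V 0) (kv 0)" "parv U W'" by blast
        obtain A3 where "parv A' A3" "parv W' A3"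
          using Suc.IH(1)[OF _ 2(2) W'(2)] h(1) 2(1) by auto
        thus ?thesis unfolding W'(1) beta_eta_body using B3 K3 par_Call by blast
      next
        assume "\<exists>M. U = Abs M \<and> parj M L2"
        then obtain M where M: "U = Abs M" "parj M L2" by blast
        \<comment> \<open>Here an eta redex in function position meets a beta step. Both results are
          also reducts of the jump in which the eta step has been done first, and that jump is
          smaller.\<close>
        have "size (Call U B K) < n" using h(1) 2(1) by simp
        moreover have "parj (Call U B K) (Call A' B1 K1)" using 2(2) h(3,4) par_Call by blast
        moreover have "parj (Call U B K) (sbj (case_nat B2 V) (case_nat K2 kv) L2)"
          unfolding M(1) using M(2) h(6,7) parv_parj.par_beta by blast
        ultimately show ?thesis by (rule Suc.IH(2))
      qed
    qed
  qed
  {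
    case 1
    from 1(2) show ?case
    proof (cases rule: parv.cases)
      case (par_V i)
      with 1(3) show ?thesis by (auto elim!: parv_VE intro: par_refl)
    next
      case (par_Abs L L1)
      from 1(3)[unfolded par_Abs(1)] show ?thesis
      proof (cases rule: parv_AbsE)
        case (1 L2)
        with Suc.IH(2)[OF _ par_Abs(3) 1(2)] \<open>size W < Suc n\<close> par_Abs show ?thesis
          by (auto intro: parv_parj.par_Abs)
      next
        case (2 U)
        with eta_Abs[OF _ 2(2), of L1] par_Abs \<open>size W < Suc n\<close> show ?thesis by auto
      qed
    next
      case (par_eta U)
      from 1(3)[unfolded par_eta(1)] show ?thesis
      proof (cases rule: parv_AbsE)
        case (1 L2)
        with eta_Abs[OF _ par_eta(2), of L2] par_eta \<open>size W < Suc n\<close> show ?thesis by auto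
      next
        case (2 U')
        with Suc.IH(1)[of U W1 W2] par_eta \<open>size W < Suc n\<close> show ?thesis
          by (auto simp: rnv_Suc_inj)
      qed
    qed
  next
    case 2
    from 2(2) show ?case
    proof (cases rule: parj.cases)
      case (par_Ret U U1 k)
      from 2(3)[unfolded par_Ret(1)] obtain U2 where "J2 = Ret k U2" "parv U U2"
        by (auto elim: parj_RetE)
      with Suc.IH(1)[of U U1 U2] par_Ret 2(1) show ?thesis by (auto intro: parv_parj.par_Ret)
    next
      case (par_Call A A1 B B1 K K1)
      from 2(3)[unfolded par_Call(1)] show ?thesis
      proof (cases rule: parj_CallE)
        case (1 A2 B2 K2)
        obtain A3 where "parv A1 A3" "parv A2 A3" using Suc.IH(1)[of A A1 A2] 1 par_Call 2(1) by auto
        moreover obtain B3 where "parv B1 B3" "parv B2 B3"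
          using Suc.IH(1)[of B B1 B2] 1 par_Call 2(1) by auto
        moreover obtain K3 where "parj K1 K3" "parj K2 K3"
          using Suc.IH(2)[of K K1 K2] 1 par_Call 2(1) by auto
        ultimately show ?thesis using 1 par_Call parv_parj.par_Call by blast
      next
        case (2 L L2 B2 K2)
        with beta_Call[of L B K A1 B1 K1 L2 B2 K2] par_Call \<open>size J < Suc n\<close> show ?thesis by auto
      qed
    next
      case (par_beta L L1 B B1 K K1)
      from 2(3)[unfolded par_beta(1)] show ?thesis
      proof (cases rule: parj_CallE)
        case (1 A2 B2 K2)
        with beta_Call[of L B K A2 B2 K2 L1 B1 K1] par_beta \<open>size J < Suc n\<close> show ?thesis by blast
      next
        case (2 L' L2 B2 K2)
        obtain L3 where "parj L1 L3" "parj L2 L3"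
          using Suc.IH(2)[of L L1 L2] 2 par_beta \<open>size J < Suc n\<close> by auto
        moreover obtain B3 where "parv B1 B3" "parv B2 B3"
          using Suc.IH(1)[of B B1 B2] 2 par_beta \<open>size J < Suc n\<close> by auto
        moreover obtain K3 where "parj K1 K3" "parj K2 K3"
          using Suc.IH(2)[of K K1 K2] 2 par_beta \<open>size J < Suc n\<close> by auto
        ultimately show ?thesis unfolding par_beta(2) 2(2)
          by (intro exI[of _ "sbj (case_nat B3 V) (case_nat K3 kv) L3"] conjI par_sb)
             (auto split: nat.split intro: par_refl)
      qed
    qed
  }
qed simp_all

lemma confluentp_parj: "confluentp parj"
  by (rule strong_confluentp_imp_confluentp, rule strong_confluentpI)
     (meson par_diamond(2) lessI r_into_rtranclp sup2CI)

section \<open>The CPS translation\<close>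

text \<open>
  \<open>cps M \<sigma> \<tau> K\<close> runs \<open>M\<close> with continuation \<open>K\<close> (which binds ordinary index 0), its free variables
  being interpreted by \<open>\<sigma>\<close> and \<open>\<tau>\<close>. With these environments, exception blocks and throws need no
  counterpart in the target.
\<close>
primrec cps :: "trm \<Rightarrow> (nat \<Rightarrow> val) \<Rightarrow> (nat \<Rightarrow> jmp) \<Rightarrow> jmp \<Rightarrow> jmp" where
  "cps (Var i) \<sigma> \<tau> K = inst (\<sigma> i) K"
| "cps (Lam M) \<sigma> \<tau> K = inst (Abs (cps M (ub \<sigma>) (rnj (up Suc) Suc \<circ> \<tau>) (kv 0))) K"
| "cps (App M N) \<sigma> \<tau> K = cps M \<sigma> \<tau>
     (cps N (rnv Suc id \<circ> \<sigma>) (tx \<tau>) (Call (V 1) (V 0) (rnj (up (Suc \<circ> Suc)) id K)))"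
| "cps (Wh L M) \<sigma> \<tau> K = cps M \<sigma> \<tau> (cps L (ux \<sigma>) (tx \<tau>) (rnj (up Suc) id K))"
| "cps (Eps M) \<sigma> \<tau> K = cps M \<sigma> (case_nat K \<tau>) K"
| "cps (Thr k M) \<sigma> \<tau> K = cps M \<sigma> \<tau> (\<tau> k)"

definition cv :: "trm \<Rightarrow> (nat \<Rightarrow> val) \<Rightarrow> (nat \<Rightarrow> jmp) \<Rightarrow> val" where
  "cv M \<sigma> \<tau> = (case M of Var i \<Rightarrow> \<sigma> i
     | Lam N \<Rightarrow> Abs (cps N (ub \<sigma>) (rnj (up Suc) Suc \<circ> \<tau>) (kv 0)))"

lemma cv_simps [simp]:
  "cv (Var i) \<sigma> \<tau> = \<sigma> i"
  "cv (Lam N) \<sigma> \<tau> = Abs (cps N (ub \<sigma>) (rnj (up Suc) Suc \<circ> \<tau>) (kv 0))"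
  by (simp_all add: cv_def)

lemma cps_val: "is_val M \<Longrightarrow> cps M \<sigma> \<tau> K = inst (cv M \<sigma> \<tau>) K"
  by (cases M) simp_all

lemma sb_tb_Suc: "sbj (ux (ub \<sigma>)) (tx (tb \<tau>)) \<circ> (rnj (up Suc) Suc \<circ> \<tau>') =
    rnj (up Suc) Suc \<circ> (sbj (ux \<sigma>) (tx \<tau>) \<circ> \<tau>')"
  for \<tau>' :: "nat \<Rightarrow> jmp"
  using arg_cong[OF sb_tb[of \<sigma> \<tau> \<tau>'], of "\<lambda>f. f \<circ> Suc"] by (simp only: comp_assoc tb_Suc)

lemma sb_tx_apply: "sbj (ux (ux \<sigma>)) (tx (tx \<tau>)) (rnj (up Suc) id K) = rnj (up Suc) id (sbj (ux \<sigma>) (tx \<tau>) K)"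
  using fun_cong[OF sb_tx[of \<sigma> \<tau> "\<lambda>_. K"]] by (simp only: tx_apply comp_apply)

lemma sb_Suc_comp: "sbv (ux \<sigma>) (tx \<tau>) \<circ> (rnv Suc id \<circ> \<sigma>') = rnv Suc id \<circ> (sbv \<sigma> \<tau> \<circ> \<sigma>')"
  for \<sigma>' :: "nat \<Rightarrow> val"
  using arg_cong[OF sb_ux[of \<sigma> \<tau> \<sigma>'], of "\<lambda>f. f \<circ> Suc"] by (simp only: comp_assoc ux_Suc)

text \<open>All target syntax that enters a translation comes from \<sigma>, \<tau> and K, so a
  substitution in the result can be made in these three beforehand.\<close>

lemma sb_cps:
  "sbj \<sigma>' \<tau>' (cps M \<sigma> \<tau> K) =
   cps M (sbv \<sigma>' \<tau>' \<circ> \<sigma>) (sbj (ux \<sigma>') (tx \<tau>') \<circ> \<tau>) (sbj (ux \<sigma>') (tx \<tau>') K)"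
proof (induction M arbitrary: \<sigma> \<tau> K \<sigma>' \<tau>')
  case (Lam M)
  have "sbj (ux (ub \<sigma>')) (tx (tb \<tau>')) (kv 0) = kv 0" by (simp add: kv_def inst_def)
  then show ?case by (simp add: sb_inst Lam.IH sb_tb_Suc del: rn_sb sb_rn sb_kv_tx comp_apply tx_apply)
next
  case (App M N)
  have up2: "rnj (up (Suc \<circ> Suc)) id L = rnj (up Suc) id (rnj (up Suc) id L)" for L
    by simp
  show ?case
    by (simp add: App.IH sb_tx up2 sb_tx_apply sb_Suc_comp del: rn_sb sb_rn rn_rn sb_kv_tx comp_apply tx_apply)
next
  case (Wh L M)
  show ?case by (simp add: Wh.IH sb_tx sb_tx_apply del: rn_sb sb_rn comp_apply tx_apply)
next
  case (Eps M)
  show ?case by (simp add: Eps.IH comp_case_nat del: comp_apply tx_apply)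
qed (simp_all add: sb_inst)

lemma vs_cps:
  "vsj \<sigma>' \<zeta> (cps M \<sigma> \<tau> K) = cps M (vsv \<sigma>' \<zeta> \<circ> \<sigma>) (vsj (ux \<sigma>') \<zeta> \<circ> \<tau>) (vsj (ux \<sigma>') \<zeta> K)"
proof -
  have "sbv \<sigma> (kv \<circ> \<zeta>) = vsv \<sigma> \<zeta>" "sbj \<sigma> (kv \<circ> \<zeta>) = vsj \<sigma> \<zeta>" for \<sigma>
    by (simp_all add: fun_eq_iff)
  with sb_cps[of \<sigma>' "kv \<circ> \<zeta>"] show ?thesis by simp
qed

lemma rn_cps:
  "rnj \<xi> \<zeta> (cps M \<sigma> \<tau> K) = cps M (rnv \<xi> \<zeta> \<circ> \<sigma>) (rnj (up \<xi>) \<zeta> \<circ> \<tau>) (rnj (up \<xi>) \<zeta> K)"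
proof -
  have "vsv (V \<circ> \<xi>) \<zeta> = rnv \<xi> \<zeta>" "vsj (V \<circ> \<xi>) \<zeta> = rnj \<xi> \<zeta>" for \<xi>
    by (simp_all add: fun_eq_iff rn_eq_vs)
  with vs_cps[of "V \<circ> \<xi>" \<zeta>] show ?thesis by simp
qed

lemma rn_cv:
  assumes "is_val M"
  shows "rnv \<xi> \<zeta> (cv M \<sigma> \<tau>) = cv M (rnv \<xi> \<zeta> \<circ> \<sigma>) (rnj (up \<xi>) \<zeta> \<circ> \<tau>)"
  using assms by (cases M) (simp_all add: rn_cps rnj_comp_rnj)

lemma rn_Suc_cv:
  assumes "is_val M"
  shows "cv M (rnv Suc id \<circ> \<sigma>) (tx \<tau>) = rnv Suc id (cv M \<sigma> \<tau>)"
    "cv M (rnv Suc Suc \<circ> \<sigma>) (rnj (up Suc) Suc \<circ> \<tau>) = rnv Suc Suc (cv M \<sigma> \<tau>)"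
  using assms by (simp_all add: rn_cv tx_def)

text \<open>Eta for continuations, the reason why \<open>r_letid\<close> becomes an
  identity.\<close>

lemma inst_up_Suc [simp]: "inst (V 0) (rnj (up Suc) \<zeta> K) = rnj id \<zeta> K"
proof -
  have "case_nat (V 0) V \<circ> up Suc = V"
    by (auto simp: fun_eq_iff up_def split: nat.split)
  thus ?thesis by (simp add: inst_def)
qed

text \<open>The administrative redex of a let vanishes into the environment; hence
  \<open>r_let\<close> becomes an identity.\<close>

lemma inst_cps_Wh:
  "inst W (cps M (ux \<sigma>) (tx \<tau>) (rnj (up Suc) id K)) = cps M (case_nat W \<sigma>) \<tau> K"
proof -
  have "vsj (ux (case_nat W V)) id \<circ> tx \<tau> = \<tau>" by (simp add: fun_eq_iff)
  thus ?thesis by (simp add: inst_def vs_cps case_nat_ux)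
qed

lemma inst_cps_App:
  "inst W (cps N (rnv Suc id \<circ> \<sigma>) (tx \<tau>) (Call (V 1) (V 0) (rnj (up (Suc \<circ> Suc)) id K))) =
   cps N \<sigma> \<tau> (Call (rnv Suc id W) (V 0) (rnj (up Suc) id K))"
proof -
  have "vsj (ux (case_nat W V)) id \<circ> tx \<tau> = \<tau>" by (simp add: fun_eq_iff)
  moreover have "vsv (case_nat W V) id \<circ> (rnv Suc id \<circ> \<sigma>) = \<sigma>" by (simp add: fun_eq_iff)
  moreover have "ux (ux (case_nat W V) \<circ> (Suc \<circ> Suc)) = V \<circ> up Suc"
    by (auto simp: fun_eq_iff ux_def up_def split: nat.split)
  hence "vsj (ux (ux (case_nat W V))) id (rnj (up (Suc \<circ> Suc)) id K) = rnj (up Suc) id K"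
    by (simp add: rn_eq_vs(2)[of "up Suc"])
  ultimately show ?thesis by (simp add: inst_def vs_cps)
qed

lemma cps_App_val1:
  "is_val A \<Longrightarrow> cps (App A N) \<sigma> \<tau> K =
    cps N \<sigma> \<tau> (Call (rnv Suc id (cv A \<sigma> \<tau>)) (V 0) (rnj (up Suc) id K))"
  by (simp only: cps.simps cps_val inst_cps_App)

lemma cps_App_val:
  assumes "is_val A" "is_val B"
  shows "cps (App A B) \<sigma> \<tau> K = Call (cv A \<sigma> \<tau>) (cv B \<sigma> \<tau>) K"
  using assms by (simp add: cps_App_val1 cps_val inst_def del: cps.simps)

section \<open>Translation of shifted and substituted terms\<close>

definition sh :: "nat \<Rightarrow> nat \<Rightarrow> nat" where
  "sh c i = (if i < c then i else Suc i)"

lemma sh_Suc: "sh (Suc c) = up (sh c)"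
  by (auto simp: fun_eq_iff sh_def up_def split: nat.split)

lemma sh_0: "sh 0 = Suc"
  by (auto simp: fun_eq_iff sh_def)

lemma is_val_lift [simp]: "is_val (lift_x c M) = is_val M" "is_val (lift_k c M) = is_val M"
  by (cases M; simp)+

lemma cps_lift_x: "cps (lift_x c M) \<sigma> \<tau> K = cps M (\<sigma> \<circ> sh c) \<tau> K"
  by (induction M arbitrary: c \<sigma> \<tau> K) (simp_all add: sh_Suc comp_assoc, simp add: sh_def)

lemma case_nat_sh: "case_nat a f \<circ> sh (Suc c) = case_nat a (f \<circ> sh c)"
  by (simp add: sh_Suc case_nat_up)

lemma cps_lift_k: "cps (lift_k c M) \<sigma> \<tau> K = cps M \<sigma> (\<tau> \<circ> sh c) K"
  by (induction M arbitrary: c \<sigma> \<tau> K) (simp_all add: case_nat_sh comp_assoc, simp add: sh_def)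

lemma cv_lift_x: "is_val M \<Longrightarrow> cv (lift_x c M) \<sigma> \<tau> = cv M (\<sigma> \<circ> sh c) \<tau>"
  by (cases M) (simp_all add: cps_lift_x sh_Suc, simp add: sh_def)

lemma cv_lift_k: "is_val M \<Longrightarrow> cv (lift_k c M) \<sigma> \<tau> = cv M \<sigma> (\<tau> \<circ> sh c)"
  by (cases M) (simp_all add: cps_lift_k comp_assoc)

text \<open>The environment counterpart of de Bruijn substitution at index n.\<close>

definition ins :: "nat \<Rightarrow> 'a \<Rightarrow> (nat \<Rightarrow> 'a) \<Rightarrow> nat \<Rightarrow> 'a" where
  "ins n a f i = (if i < n then f i else if i = n then a else f (i - 1))"

lemma ins_0: "ins 0 a f = case_nat a f"
  by (auto simp: fun_eq_iff ins_def split: nat.split)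

lemma case_nat_ins: "case_nat b (ins n a f) = ins (Suc n) a (case_nat b f)"
  by (auto simp: fun_eq_iff ins_def split: nat.split)

lemma comp_ins: "g \<circ> ins n a f = ins n (g a) (g \<circ> f)"
  by (auto simp: fun_eq_iff ins_def)

lemma ux_ins: "ux (ins n W \<sigma>) = ins (Suc n) (rnv Suc id W) (ux \<sigma>)"
  by (simp add: ux_def case_nat_ins comp_ins)

lemma ub_ins: "ub (ins n W \<sigma>) = ins (Suc n) (rnv Suc Suc W) (ub \<sigma>)"
  by (simp add: ub_def case_nat_ins comp_ins)

lemma cps_subst_x:
  "is_val U \<Longrightarrow> cps (subst_x n U M) \<sigma> \<tau> K = cps M (ins n (cv U \<sigma> \<tau>) \<sigma>) \<tau> K"
proof (induction M arbitrary: n U \<sigma> \<tau> K)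
  case (Var i)
  then show ?case by (simp add: ins_def cps_val)
next
  case (Lam M)
  then show ?case by (simp add: ub_ins cv_lift_x sh_0 rn_Suc_cv del: comp_apply)
next
  case (App M N)
  then show ?case by (simp add: comp_ins rn_Suc_cv del: comp_apply tx_apply)
next
  case (Wh L M)
  then show ?case by (simp add: ux_ins cv_lift_x sh_0 rn_Suc_cv del: comp_apply tx_apply)
next
  case (Eps M)
  then show ?case by (simp add: cv_lift_k sh_0)
qed simp

text \<open>The renaming performed by \<open>subst_k n l\<close>: the target \<open>l\<close> is relative to depth \<open>n\<close>.\<close>
definition mg :: "nat \<Rightarrow> nat \<Rightarrow> nat \<Rightarrow> nat" where
  "mg n l = ins n (l + n) id"

lemma mg_Suc: "mg (Suc n) l = up (mg n l)"
  by (auto simp: fun_eq_iff mg_def ins_def up_def split: nat.split)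

lemma cps_subst_k: "cps (subst_k n l M) \<sigma> \<tau> K = cps M \<sigma> (\<tau> \<circ> mg n l) K"
  by (induction M arbitrary: n \<sigma> \<tau> K)
     (simp_all add: comp_assoc mg_Suc case_nat_up, simp add: mg_def ins_def)

lemma fun_upd_case_nat: "(case_nat a f)(Suc k := b) = case_nat a (f(k := b))"
  by (auto simp: fun_eq_iff split: nat.split)

lemma comp_fun_upd: "g \<circ> f(k := b) = (g \<circ> f)(k := g b)"
  by (auto simp: fun_eq_iff)

lemma cps_lift_x1: "cps (lift_x (Suc 0) P) \<sigma> \<tau> K = cps P (\<sigma> \<circ> up Suc) \<tau> K"
  by (simp add: cps_lift_x sh_Suc sh_0)

text \<open>After the replacement, a throw to k runs P first and then continues as k did before. One
  update of \<tau> accounts for all these throws, at any depth.\<close>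

lemma cps_repl:
  "cps (repl k P N) \<sigma> \<tau> K =
   cps N \<sigma> (\<tau>(k := cps P (ux \<sigma>) (tx \<tau>) (rnj (up Suc) id (\<tau> k)))) K"
proof (induction N arbitrary: k P \<sigma> \<tau> K)
  case (Lam N)
  have "ux (rnv Suc Suc \<circ> \<sigma>) = rnv (up Suc) Suc \<circ> ux \<sigma>"
    by (simp add: ux_ub_up_Suc[symmetric])
  moreover have "rnj (up Suc) id ((rnj (up Suc) Suc \<circ> \<tau>) k) = rnj (up (Suc \<circ> Suc)) Suc (\<tau> k)"
    by simp
  ultimately show ?case
    by (simp add: Lam.IH comp_fun_upd rn_cps cps_lift_x1 rnj_comp_rnj tx_def del: comp_apply id_apply fun_upd_apply)
next
  case (App N1 N2)
  have "ux (rnv Suc id \<circ> \<sigma>) = rnv (up Suc) id \<circ> ux \<sigma>"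
    "rnj (up Suc) id ((rnj (up Suc) id \<circ> \<tau>) k) = rnj (up (Suc \<circ> Suc)) id (\<tau> k)" by simp_all
  then show ?case
    by (simp add: App.IH comp_fun_upd rn_cps tx_def rnj_comp_rnj del: rn_ux comp_apply id_apply fun_upd_apply)
next
  case (Wh L M)
  have "ux (rnv Suc id \<circ> \<sigma>) = rnv (up Suc) id \<circ> ux \<sigma>"
    "rnj (up Suc) id ((rnj (up Suc) id \<circ> \<tau>) k) = rnj (up (Suc \<circ> Suc)) id (\<tau> k)" by simp_all
  then show ?case
    by (simp add: Wh.IH comp_fun_upd rn_cps cps_lift_x1 tx_def rnj_comp_rnj del: rn_ux comp_apply id_apply fun_upd_apply)
next
  case (Eps N)
  show ?case
    by (simp add: Eps.IH cps_lift_k sh_0 fun_upd_case_nat del: comp_apply tx_apply fun_upd_apply id_apply)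
qed simp_all

text \<open>A step in the argument of an application or in the body of a let happens inside the
  continuation of another term, which may copy or drop it; parallel reduction covers all copies at
  once.\<close>

lemma par_cps:
  "parj K K' \<Longrightarrow> (\<And>k. parj (\<tau> k) (\<tau>' k)) \<Longrightarrow> parj (cps M \<sigma> \<tau> K) (cps M \<sigma> \<tau>' K')"
proof (induction M arbitrary: \<sigma> \<tau> \<tau>' K K')
  case (App M N)
  show ?case unfolding cps.simps
    by (intro App.IH App.prems par_tx par_Call par_refl par_rn)
next
  case (Wh M N)
  show ?case unfolding cps.simps by (intro Wh.IH Wh.prems par_tx par_rn)
next
  case (Eps M)
  show ?case unfolding cps.simps
    by (intro Eps.IH Eps.prems) (auto split: nat.split intro: Eps.prems)
next
  case (Lam M)
  show ?case unfolding cps.simps comp_def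
    by (intro Lam.IH Lam.prems par_inst par_Abs par_rn par_refl)
qed (auto intro: par_inst par_refl)

section \<open>Soundness of the translation\<close>

lemma equivclp_map:
  assumes "equivclp r x y" "\<And>x y. r x y \<Longrightarrow> s (f x) (f y)"
  shows "equivclp s (f x) (f y)"
  using assms(1)
  by (induction rule: equivclp_induct) (auto dest: assms(2) intro: equivclp_into_equivclp)

lemma cps_sc: "sc M N \<Longrightarrow> cps M \<sigma> \<tau> K = cps N \<sigma> \<tau> K"
proof (induction arbitrary: \<sigma> \<tau> K rule: sc.induct)
  case (sc_assoc L M N)
  have "ux (rnv Suc id \<circ> \<sigma>) = rnv (up Suc) id \<circ> ux \<sigma>" by simp
  then show ?case
    by (simp add: cps_lift_x1 rn_cps tx_def rnj_comp_rnj del: rn_ux comp_apply id_apply fun_upd_apply)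
next
  case (sc_eps M N)
  have "tx (case_nat K \<tau>) = case_nat (rnj (up Suc) id K) (tx \<tau>)"
    by (simp add: tx_def comp_case_nat)
  then show ?case by (simp add: cps_lift_k sh_0)
qed simp_all

lemma mg_0: "mg 0 l = case_nat l id"
  by (simp add: mg_def ins_0)

lemma fun_upd_case_nat_0: "(case_nat a f)(0 := b) = case_nat b f"
  by (auto simp: fun_eq_iff split: nat.split)

lemma sb_cps_ub:
  "sbj (case_nat W V) (case_nat K kv) (cps M (ub \<sigma>) (rnj (up Suc) Suc \<circ> \<tau>) (kv 0)) =
   cps M (case_nat W \<sigma>) \<tau> K"
proof -
  have "sbj (ux (case_nat W V)) (tx (case_nat K kv)) \<circ> (rnj (up Suc) Suc \<circ> \<tau>) = \<tau>"
    using arg_cong[OF sb_case_tx_tb[of W K \<tau>], of "\<lambda>f. f \<circ> Suc"]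
    by (simp only: comp_assoc tb_Suc case_nat_Suc)
  thus ?thesis by (simp add: sb_cps case_nat_ub)
qed

text \<open>The function is evaluated before the argument, so binding it by a let leaves the order
  of evaluation as it is.\<close>

lemma cps_app1: "cps (App N M) \<sigma> \<tau> K = cps (Wh (App (Var 0) (lift_x 0 M)) N) \<sigma> \<tau> K"
proof -
  have "cps (App (Var 0) (lift_x 0 M)) (ux \<sigma>) (tx \<tau>) (rnj (up Suc) id K) =
    cps M (rnv Suc id \<circ> \<sigma>) (tx \<tau>) (Call (V 1) (V 0) (rnj (up (Suc \<circ> Suc)) id K))"
    by (subst cps_App_val1) (simp_all add: cps_lift_x sh_0)
  then show ?thesis by simp
qed

lemma cps_app2:
  assumes "is_val U"
  shows "cps (App U N) \<sigma> \<tau> K = cps (Wh (App (lift_x 0 U) (Var 0)) N) \<sigma> \<tau> K"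
proof -
  have "cps (App (lift_x 0 U) (Var 0)) (ux \<sigma>) (tx \<tau>) (rnj (up Suc) id K) =
    Call (rnv Suc id (cv U \<sigma> \<tau>)) (V 0) (rnj (up Suc) id K)"
    using assms by (subst cps_App_val) (simp_all add: cv_lift_x sh_0 rn_Suc_cv)
  with assms show ?thesis by (simp only: cps_App_val1 cps.simps(4))
qed

text \<open>Only \<open>r_beta\<close> and \<open>r_eta\<close> need the second alternative. The
  discarding rules are equations because a throw ignores K, the merging rules because a block
  interprets its name by K itself.\<close>

lemma cps_rstep: "rstep M N \<Longrightarrow> cps M \<sigma> \<tau> K = cps N \<sigma> \<tau> K \<or> parj (cps M \<sigma> \<tau> K) (cps N \<sigma> \<tau> K)"
proof (induction rule: rstep.induct)
  case (r_app1 N M)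
  then show ?case by (simp only: cps_app1 simp_thms)
next
  case (r_app2 U N)
  then show ?case by (simp only: cps_app2 simp_thms)
next
  case (r_beta U M)
  have "cps (Wh M U) \<sigma> \<tau> K = cps M (case_nat (cv U \<sigma> \<tau>) \<sigma>) \<tau> K"
    using r_beta by (simp add: cps_val inst_cps_Wh)
  moreover have "parj (Call (Abs (cps M (ub \<sigma>) (rnj (up Suc) Suc \<circ> \<tau>) (kv 0))) (cv U \<sigma> \<tau>) K)
    (cps M (case_nat (cv U \<sigma> \<tau>) \<sigma>) \<tau> K)"
    unfolding sb_cps_ub[symmetric] by (intro par_beta par_refl)
  ultimately show ?case using r_beta by (simp only: cps_App_val is_val.simps cv_simps simp_thms)
next
  case (r_let U M)
  then show ?case by (simp add: cps_val inst_cps_Wh cps_subst_x ins_0)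
next
  case (r_eta U)
  have "cps (App (lift_x 0 U) (Var 0)) (ub \<sigma>) (rnj (up Suc) Suc \<circ> \<tau>) (kv 0) =
    Call (rnv Suc Suc (cv U \<sigma> \<tau>)) (V 0) (kv 0)"
    using r_eta by (subst cps_App_val) (simp_all add: cv_lift_x sh_0 rn_Suc_cv)
  moreover have "parj (inst (Abs (Call (rnv Suc Suc (cv U \<sigma> \<tau>)) (V 0) (kv 0))) K) (inst (cv U \<sigma> \<tau>) K)"
    by (intro par_inst par_eta par_refl)
  ultimately show ?case using r_eta by (simp only: cps.simps(2) cps_val simp_thms)
next
  case (r_wheps M N)
  have "tx (case_nat K \<tau>) = case_nat (rnj (up Suc) id K) (tx \<tau>)"
    by (simp add: tx_def comp_case_nat)
  then show ?case
    by (simp add: cps_repl cps_lift_k sh_0 fun_upd_case_nat_0)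
qed (simp_all add: cps_lift_k sh_0 cps_subst_k mg_0 comp_case_nat)

lemma cps_cstep: "cstep M N \<Longrightarrow> equivclp parj (cps M \<sigma> \<tau> K) (cps N \<sigma> \<tau> K)"
proof (induction arbitrary: \<sigma> \<tau> K rule: cstep.induct)
  case (c_root M N)
  with cps_rstep[OF this, of \<sigma> \<tau> K] show ?case by (auto simp: r_into_equivclp)
next
  case (c_Lam M M')
  show ?case unfolding cps.simps
    by (rule equivclp_map[OF c_Lam.IH]) (intro par_inst par_Abs par_refl)
next
  case (c_App2 N N' M)
  show ?case unfolding cps.simps
    by (rule equivclp_map[OF c_App2.IH]) (intro par_cps par_refl)
next
  case (c_Wh1 M M' N)
  show ?case unfolding cps.simps
    by (rule equivclp_map[OF c_Wh1.IH]) (intro par_cps par_refl)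
qed simp_all

lemma cps_conv:
  assumes "conv M N"
  shows "equivclp parj (cps M \<sigma> \<tau> K) (cps N \<sigma> \<tau> K)"
proof -
  have red: "equivclp parj (cps M \<sigma> \<tau> K) (cps N \<sigma> \<tau> K)" if "red M N \<or> sc M N" for M N
    using that
  proof
    assume "red M N"
    then obtain M' N' where "sc M M'" "cstep M' N'" "sc N' N" unfolding red_def by blast
    with cps_cstep[of M' N' \<sigma> \<tau> K] show ?thesis
      by (simp add: cps_sc[of M M'] cps_sc[of N' N])
  qed (simp add: cps_sc[of M N])
  show ?thesis
    using assms unfolding conv_def
  proof (induction rule: equivclp_induct)
    case (step X Y)
    hence "equivclp parj (cps X \<sigma> \<tau> K) (cps Y \<sigma> \<tau> K)"
      using red equivclp_sym by meson
    with step.IH show ?case by (rule equivclp_trans)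
  qed simp
qed

section \<open>Renaming and free continuation variables of terms\<close>

primrec srn :: "(nat \<Rightarrow> nat) \<Rightarrow> (nat \<Rightarrow> nat) \<Rightarrow> trm \<Rightarrow> trm" where
  "srn \<xi> \<zeta> (Var i) = Var (\<xi> i)"
| "srn \<xi> \<zeta> (Lam M) = Lam (srn (up \<xi>) \<zeta> M)"
| "srn \<xi> \<zeta> (App M N) = App (srn \<xi> \<zeta> M) (srn \<xi> \<zeta> N)"
| "srn \<xi> \<zeta> (Wh L M) = Wh (srn (up \<xi>) \<zeta> L) (srn \<xi> \<zeta> M)"
| "srn \<xi> \<zeta> (Eps M) = Eps (srn \<xi> (up \<zeta>) M)"
| "srn \<xi> \<zeta> (Thr k M) = Thr (\<zeta> k) (srn \<xi> \<zeta> M)"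

lemma srn_srn [simp]: "srn \<xi> \<zeta> (srn \<xi>' \<zeta>' M) = srn (\<xi> \<circ> \<xi>') (\<zeta> \<circ> \<zeta>') M"
  by (induction M arbitrary: \<xi> \<zeta> \<xi>' \<zeta>') simp_all

lemma srn_id [simp]: "srn id id M = M"
  by (induction M) (simp_all del: id_apply, simp_all)

definition usx :: "(nat \<Rightarrow> trm) \<Rightarrow> nat \<Rightarrow> trm" where
  "usx \<sigma> = case_nat (Var 0) (srn Suc id \<circ> \<sigma>)"

text \<open>The source counterpart of \<open>vsv\<close>; \<open>rb_vs\<close> relates the
  two.\<close>

primrec ssb :: "(nat \<Rightarrow> trm) \<Rightarrow> (nat \<Rightarrow> nat) \<Rightarrow> trm \<Rightarrow> trm" where
  "ssb \<sigma> \<zeta> (Var i) = \<sigma> i"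
| "ssb \<sigma> \<zeta> (Lam M) = Lam (ssb (usx \<sigma>) \<zeta> M)"
| "ssb \<sigma> \<zeta> (App M N) = App (ssb \<sigma> \<zeta> M) (ssb \<sigma> \<zeta> N)"
| "ssb \<sigma> \<zeta> (Wh L M) = Wh (ssb (usx \<sigma>) \<zeta> L) (ssb \<sigma> \<zeta> M)"
| "ssb \<sigma> \<zeta> (Eps M) = Eps (ssb (srn id Suc \<circ> \<sigma>) (up \<zeta>) M)"
| "ssb \<sigma> \<zeta> (Thr k M) = Thr (\<zeta> k) (ssb \<sigma> \<zeta> M)"

lemma usx_Var: "usx (Var \<circ> \<xi>) = Var \<circ> up \<xi>"
  by (auto simp: fun_eq_iff usx_def up_def split: nat.split)

lemma srn_comp_Var: "srn \<xi> \<zeta> \<circ> (Var \<circ> \<xi>') = Var \<circ> (\<xi> \<circ> \<xi>')"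
  by (simp add: fun_eq_iff)

lemma srn_eq_ssb: "srn \<xi> \<zeta> M = ssb (Var \<circ> \<xi>) \<zeta> M"
  by (induction M arbitrary: \<xi> \<zeta>) (simp_all add: usx_Var srn_comp_Var)

lemma usx_up: "usx \<sigma> \<circ> up \<xi> = usx (\<sigma> \<circ> \<xi>)"
  by (auto simp: fun_eq_iff usx_def up_def split: nat.split)

lemma ssb_srn: "ssb \<sigma> \<zeta> (srn \<xi> \<zeta>' M) = ssb (\<sigma> \<circ> \<xi>) (\<zeta> \<circ> \<zeta>') M"
  by (induction M arbitrary: \<sigma> \<zeta> \<xi> \<zeta>') (simp_all add: usx_up comp_assoc)

lemma srn_usx: "srn (up \<xi>) \<zeta> \<circ> usx \<sigma> = usx (srn \<xi> \<zeta> \<circ> \<sigma>)"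
  by (auto simp: fun_eq_iff usx_def split: nat.split)

lemma srn_comp_srn: "srn \<xi> \<zeta> \<circ> (srn \<xi>' \<zeta>' \<circ> \<sigma>) = srn (\<xi> \<circ> \<xi>') (\<zeta> \<circ> \<zeta>') \<circ> \<sigma>"
  by (simp add: fun_eq_iff)

lemma srn_ssb: "srn \<xi> \<zeta> (ssb \<sigma> \<zeta>' M) = ssb (srn \<xi> \<zeta> \<circ> \<sigma>) (\<zeta> \<circ> \<zeta>') M"
  by (induction M arbitrary: \<sigma> \<zeta> \<xi> \<zeta>') (simp_all add: srn_usx srn_comp_srn)

primrec fk :: "nat \<Rightarrow> trm \<Rightarrow> bool" where
  "fk i (Var _) \<longleftrightarrow> False"
| "fk i (Lam M) \<longleftrightarrow> fk i M"
| "fk i (App M N) \<longleftrightarrow> fk i M \<or> fk i N"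
| "fk i (Wh L M) \<longleftrightarrow> fk i L \<or> fk i M"
| "fk i (Eps M) \<longleftrightarrow> fk (Suc i) M"
| "fk i (Thr k M) \<longleftrightarrow> i = k \<or> fk i M"

lemma up_eq_Suc: "up f j = Suc i \<longleftrightarrow> (\<exists>m. j = Suc m \<and> f m = i)"
  by (cases j) auto

lemma fk_srn: "fk i (srn \<xi> \<zeta> M) \<longleftrightarrow> (\<exists>j. \<zeta> j = i \<and> fk j M)"
  by (induction M arbitrary: i \<xi> \<zeta>) (auto simp: up_eq_Suc)

lemma fk_lift [simp]: "\<not> fk 0 (srn \<xi> Suc M)" "fk (Suc i) (srn \<xi> Suc M) \<longleftrightarrow> fk i M"
  by (auto simp: fk_srn)

lemma fk_usx: "(\<exists>m. fk i (usx \<sigma> m)) \<longleftrightarrow> (\<exists>m. fk i (\<sigma> m))"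
proof
  assume "\<exists>m. fk i (usx \<sigma> m)"
  then obtain m where "fk i (usx \<sigma> m)" by blast
  thus "\<exists>m. fk i (\<sigma> m)" by (cases m) (auto simp: usx_def fk_srn)
next
  assume "\<exists>m. fk i (\<sigma> m)"
  then obtain m where "fk i (\<sigma> m)" by blast
  hence "fk i (usx \<sigma> (Suc m))" by (simp add: usx_def fk_srn)
  thus "\<exists>m. fk i (usx \<sigma> m)" by blast
qed

lemma fk_ssbD: "fk i (ssb \<sigma> \<zeta> M) \<Longrightarrow> (\<exists>j. \<zeta> j = i \<and> fk j M) \<or> (\<exists>m. fk i (\<sigma> m))"
proof (induction M arbitrary: i \<sigma> \<zeta>)
  case (Lam M)
  from Lam.IH[of i "usx \<sigma>" \<zeta>] Lam.prems show ?case by (simp add: fk_usx)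
next
  case (Wh L M)
  from Wh.IH(1)[of i "usx \<sigma>" \<zeta>] Wh.IH(2)[of i \<sigma> \<zeta>] Wh.prems show ?case
    by (auto simp: fk_usx)
next
  case (Eps M)
  from Eps.IH[of "Suc i" "srn id Suc \<circ> \<sigma>" "up \<zeta>"] Eps.prems show ?case
    by (auto simp: up_eq_Suc fk_srn comp_def)
next
  case (App M N)
  from App.IH(1)[of i \<sigma> \<zeta>] App.IH(2)[of i \<sigma> \<zeta>] App.prems show ?case by auto
next
  case (Thr k M)
  from Thr.IH[of i \<sigma> \<zeta>] Thr.prems show ?case by auto
qed auto

lemma fk_ssbI: "fk j M \<Longrightarrow> fk (\<zeta> j) (ssb \<sigma> \<zeta> M)"
proof (induction M arbitrary: j \<sigma> \<zeta>)
  case (Eps M)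
  from Eps.IH[of "Suc j" "up \<zeta>"] Eps.prems show ?case by simp
qed auto

lemma ssb_cong: "(\<And>j. fk j M \<Longrightarrow> \<zeta> j = \<zeta>' j) \<Longrightarrow> ssb \<sigma> \<zeta> M = ssb \<sigma> \<zeta>' M"
proof (induction M arbitrary: \<sigma> \<zeta> \<zeta>')
  case (Eps M)
  have "up \<zeta> j = up \<zeta>' j" if "fk j M" for j
    using that Eps.prems by (cases j) auto
  then show ?case by (simp, intro Eps.IH)
next
  case (Lam M)
  show ?case by (simp, intro Lam.IH Lam.prems) simp
next
  case (App M N)
  show ?case by (simp, intro conjI App.IH App.prems) simp_all
next
  case (Wh L M)
  show ?case by (simp, intro conjI Wh.IH Wh.prems) simp_all
next
  case (Thr k M)
  show ?case by (simp, intro conjI Thr.IH Thr.prems) simp_all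
qed simp

lemma srn_cong: "(\<And>j. fk j M \<Longrightarrow> \<zeta> j = \<zeta>' j) \<Longrightarrow> srn \<xi> \<zeta> M = srn \<xi> \<zeta>' M"
  unfolding srn_eq_ssb by (rule ssb_cong)

lemma lift_x_srn: "lift_x c M = srn (sh c) id M"
  by (induction M arbitrary: c) (simp_all add: sh_Suc, simp add: sh_def)

lemma lift_k_srn: "lift_k c M = srn id (sh c) M"
  by (induction M arbitrary: c) (simp_all add: sh_Suc, simp add: sh_def)

lemma subst_k_srn: "subst_k n l M = srn id (mg n l) M"
  by (induction M arbitrary: n) (simp_all add: mg_Suc, simp add: mg_def ins_def)

lemma usx_ins: "usx (ins n U Var) = ins (Suc n) (srn Suc id U) Var"
  by (auto simp: fun_eq_iff usx_def case_nat_ins comp_ins) (auto simp: ins_def split: nat.split)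

lemma subst_x_ssb: "subst_x n U M = ssb (ins n U Var) id M"
proof (induction M arbitrary: n U)
  case (Eps M)
  have "srn id Suc \<circ> ins n U Var = ins n (srn id Suc U) Var"
    by (auto simp: fun_eq_iff ins_def)
  with Eps show ?case by (simp add: lift_k_srn sh_0 del: id_apply)
qed (simp_all add: usx_ins lift_x_srn sh_0, simp add: ins_def)

lemmas srn_defs = lift_x_srn lift_k_srn subst_k_srn sh_0 sh_Suc

text \<open>Were another name sent to \<open>\<zeta> k\<close>, its throws would be replaced on the
  right but not on the left; hence the injectivity at k.\<close>

lemma srn_repl:
  "(\<And>j. \<zeta> j = \<zeta> k \<Longrightarrow> j = k) \<Longrightarrow>
   srn \<xi> \<zeta> (repl k P N) = repl (\<zeta> k) (srn (up \<xi>) \<zeta> P) (srn \<xi> \<zeta> N)"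
proof (induction N arbitrary: k P \<xi> \<zeta>)
  case (Eps N)
  have "j = Suc k" if "up \<zeta> j = up \<zeta> (Suc k)" for j
    using that Eps.prems by (cases j) auto
  from Eps.IH[of "up \<zeta>" "Suc k", OF this] show ?case
    by (simp add: srn_defs)
qed (auto simp: srn_defs)

lemma fk_replD: "fk i (repl k P N) \<Longrightarrow> fk i N \<or> fk i P"
proof (induction N arbitrary: i k P)
  case (Eps N)
  from Eps.IH[of "Suc i" "Suc k" "lift_k 0 P"] Eps.prems show ?case by (simp add: srn_defs)
next
  case (Lam N)
  from Lam.IH[of i k "lift_x 1 P"] Lam.prems show ?case by (simp add: srn_defs fk_srn)
next
  case (Wh L M)
  from Wh.IH(1)[of i k "lift_x 1 P"] Wh.IH(2)[of i k P] Wh.prems show ?case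
    by (auto simp add: srn_defs fk_srn)
next
  case (App M N)
  from App.IH(1)[of i k P] App.IH(2)[of i k P] App.prems show ?case by auto
next
  case (Thr j N)
  from Thr.IH[of i k P] Thr.prems show ?case by (auto split: if_splits)
qed simp

lemma fk_replI: "fk i N \<Longrightarrow> fk i (repl k P N)"
  by (induction N arbitrary: i k P) auto

lemma repl_fresh: "\<not> fk k N \<Longrightarrow> repl k P N = N"
  by (induction N arbitrary: k P) auto

lemma is_val_srn [simp]: "is_val (srn \<xi> \<zeta> M) = is_val M"
  by (cases M) auto

lemma sc_srn: "sc M N \<Longrightarrow> sc (srn \<xi> \<zeta> M) (srn \<xi> \<zeta> N)"
proof (induction arbitrary: \<xi> \<zeta> rule: sc.induct)
  case (sc_assoc L M N)
  show ?case using sc.sc_assoc[of "srn (up \<xi>) \<zeta> L"] by (simp add: srn_defs)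
next
  case (sc_eps M N)
  show ?case using sc.sc_eps[of "srn (up \<xi>) (up \<zeta>) M" "srn \<xi> \<zeta> N"] by (simp add: srn_defs)
next
  case (sc_trans M N P)
  from sc.sc_trans[OF sc_trans.IH] show ?case .
qed (auto intro: sc.intros)

lemma srn_mg: "\<zeta> \<circ> mg 0 l = mg 0 (\<zeta> l) \<circ> up \<zeta>"
  by (auto simp: fun_eq_iff mg_0 up_def split: nat.split)

lemma rstep_srn: "rstep M N \<Longrightarrow> rstep (srn \<xi> \<zeta> M) (srn \<xi> \<zeta> N)"
proof (induction rule: rstep.induct)
  case (r_app1 N M)
  then show ?case using rstep.r_app1[of "srn \<xi> \<zeta> N" "srn \<xi> \<zeta> M"] by (simp add: srn_defs)
next
  case (r_app2 U N)
  then show ?case using rstep.r_app2[of "srn \<xi> \<zeta> U" "srn \<xi> \<zeta> N"] by (simp add: srn_defs)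
next
  case (r_let U M)
  have "srn \<xi> \<zeta> \<circ> ins 0 U Var = ins 0 (srn \<xi> \<zeta> U) Var \<circ> up \<xi>"
    by (auto simp: fun_eq_iff ins_def up_def split: nat.split)
  then show ?case using rstep.r_let[of "srn \<xi> \<zeta> U" "srn (up \<xi>) \<zeta> M"] r_let
    by (simp add: subst_x_ssb srn_ssb ssb_srn)
next
  case (r_eta U)
  then show ?case using rstep.r_eta[of "srn \<xi> \<zeta> U"] by (simp add: srn_defs)
next
  case (r_epsgc M)
  show ?case using rstep.r_epsgc[of "srn \<xi> \<zeta> M"] by (simp add: srn_defs)
next
  case (r_wheps M N)
  have "srn \<xi> (up \<zeta>) (repl 0 (lift_k 0 M) N) =
    repl 0 (lift_k 0 (srn (up \<xi>) \<zeta> M)) (srn \<xi> (up \<zeta>) N)"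
    by (subst srn_repl) (simp_all add: srn_defs)
  then show ?case using rstep.r_wheps[of "srn (up \<xi>) \<zeta> M" "srn \<xi> (up \<zeta>) N"]
    by (simp add: srn_defs)
next
  case (r_threps l M)
  show ?case using rstep.r_threps[of "\<zeta> l" "srn \<xi> (up \<zeta>) M"] by (simp add: srn_defs srn_mg)
next
  case (r_epseps M)
  show ?case using rstep.r_epseps[of "srn \<xi> (up (up \<zeta>)) M"]
    by (simp add: srn_defs srn_mg[of "up \<zeta>" 0])
qed (auto intro: rstep.intros)

lemma cstep_srn: "cstep M N \<Longrightarrow> cstep (srn \<xi> \<zeta> M) (srn \<xi> \<zeta> N)"
  by (induction arbitrary: \<xi> \<zeta> rule: cstep.induct) (auto intro: cstep.intros rstep_srn)

lemma fk_sc: "sc M N \<Longrightarrow> fk i M \<longleftrightarrow> fk i N"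
  by (induction arbitrary: i rule: sc.induct) (auto simp: srn_defs fk_srn)

lemma fk_mg: "fk i (srn id (mg 0 l) M) \<Longrightarrow> fk (Suc i) M \<or> i = l"
proof -
  assume "fk i (srn id (mg 0 l) M)"
  then obtain j where "mg 0 l j = i" "fk j M" by (auto simp: fk_srn)
  thus ?thesis by (cases j) (auto simp: mg_0)
qed

lemma fk_rstep: "rstep M N \<Longrightarrow> fk i N \<Longrightarrow> fk i M"
proof (induction rule: rstep.induct)
  case (r_let U M)
  from r_let.prems fk_ssbD[of i "ins 0 U Var" id M] show ?case
    by (auto simp: subst_x_ssb ins_def split: if_splits)
next
  case (r_wheps M N)
  then show ?case by (auto simp: srn_defs dest!: fk_replD)
next
  case (r_epseps M)
  then show ?case by (auto simp: srn_defs dest: fk_mg)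
next
  case (r_threps l M)
  then show ?case by (auto simp: srn_defs dest: fk_mg)
qed (auto simp: srn_defs fk_srn)

lemma fk_cstep: "cstep M N \<Longrightarrow> fk i N \<Longrightarrow> fk i M"
  by (induction arbitrary: i rule: cstep.induct) (auto dest: fk_rstep)

section \<open>Reduction sequences\<close>

lemma reds_refl [simp]: "reds M M"
  by (simp add: reds_def)

lemma reds_trans [trans]: "reds M N \<Longrightarrow> reds N P \<Longrightarrow> reds M P"
  by (auto simp: reds_def)

lemma reds_sc: "sc M N \<Longrightarrow> reds M N"
  by (auto simp: reds_def)

lemma reds_cstep: "cstep M N \<Longrightarrow> reds M N"
  unfolding reds_def red_def by (blast intro: sc_refl r_into_rtranclp)

lemma reds_rstep: "rstep M N \<Longrightarrow> reds M N"
  by (intro reds_cstep c_root)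

lemma reds_induct [consumes 1, case_names refl sc cstep]:
  assumes "reds M N" "P M" "\<And>X Y. P X \<Longrightarrow> sc X Y \<Longrightarrow> P Y" "\<And>X Y. P X \<Longrightarrow> cstep X Y \<Longrightarrow> P Y"
  shows "P N"
  using assms(1) unfolding reds_def
proof (induction rule: rtranclp_induct)
  case (step X Y)
  then show ?case unfolding red_def using assms(3,4) by metis
qed (rule assms)

lemma reds_map:
  assumes "reds M N" "\<And>X Y. sc X Y \<Longrightarrow> sc (f X) (f Y)" "\<And>X Y. cstep X Y \<Longrightarrow> cstep (f X) (f Y)"
  shows "reds (f M) (f N)"
  using assms(1)
proof (induction rule: reds_induct)
  case (sc X Y)
  then show ?case using assms(2) reds_sc reds_trans by blast
next
  case (cstep X Y)
  then show ?case using assms(3) reds_cstep reds_trans by blast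
qed simp

lemma reds_srn: "reds M N \<Longrightarrow> reds (srn \<xi> \<zeta> M) (srn \<xi> \<zeta> N)"
  by (erule reds_map) (intro sc_srn cstep_srn | assumption)+

lemma reds_Lam: "reds M N \<Longrightarrow> reds (Lam M) (Lam N)"
  by (erule reds_map) (auto intro: sc.intros cstep.intros)

lemma reds_Eps: "reds M N \<Longrightarrow> reds (Eps M) (Eps N)"
  by (erule reds_map) (auto intro: sc.intros cstep.intros)

lemma reds_Thr: "reds M N \<Longrightarrow> reds (Thr k M) (Thr k N)"
  by (erule reds_map) (auto intro: sc.intros cstep.intros)

lemma reds_App: "reds M M' \<Longrightarrow> reds N N' \<Longrightarrow> reds (App M N) (App M' N')"
  by (rule reds_trans[of _ "App M' N"]; erule reds_map) (auto intro: sc.intros cstep.intros)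

lemma reds_Wh: "reds M M' \<Longrightarrow> reds N N' \<Longrightarrow> reds (Wh M N) (Wh M' N')"
  by (rule reds_trans[of _ "Wh M' N"]; erule reds_map) (auto intro: sc.intros cstep.intros)

lemma fk_reds: "reds M N \<Longrightarrow> fk i N \<Longrightarrow> fk i M"
  by (induction rule: reds_induct) (auto dest: fk_sc fk_cstep)

lemma sc_VarD: "sc M N \<Longrightarrow> (M = Var i \<longleftrightarrow> N = Var i)"
  by (induction rule: sc.induct) auto

text \<open>\<open>wh\<close> tests literally for \<open>Var 0\<close>. The test is compatible with
  reduction because variables are normal and alone in their congruence class.\<close>

lemma reds_VarD: "reds (Var i) N \<Longrightarrow> N = Var i"
proof (induction rule: reds_induct)
  case (cstep X Y)
  then show ?case by (auto elim: cstep.cases rstep.cases)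
qed (auto dest: sc_VarD)

section \<open>Reading back\<close>

text \<open>
  \<open>gc X\<close>, \<open>gc (thr k E)\<close> and \<open>wh E A\<close> are reducts of \<open>Eps X\<close>, \<open>Eps (Thr k E)\<close> and \<open>Wh E A\<close>. They are
  needed for terms to reduce to their read-backs: \<open>M\<close> does not reduce to \<open>Eps (Thr 0 M)\<close> (for
  fresh 0) or \<open>Wh (Var 0) M\<close>.
\<close>
definition gc :: "trm \<Rightarrow> trm" where
  "gc X = (if fk 0 X then Eps X else srn id (\<lambda>n. n - 1) X)"

lemma gc_lift [simp]: "gc (srn id Suc X) = X"
proof -
  have "(\<lambda>n. n - 1) \<circ> Suc = id" by auto
  thus ?thesis by (simp add: gc_def)
qed

lemma lift_of_fresh: "\<not> fk 0 X \<Longrightarrow> X = srn id Suc (srn id (\<lambda>n. n - 1) X)"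
proof -
  assume "\<not> fk 0 X"
  hence "srn id id X = srn id (Suc \<circ> (\<lambda>n. n - 1)) X"
    by (intro srn_cong) (metis Suc_pred' comp_apply gr0I id_apply)
  thus ?thesis by simp
qed

lemma gc_cases [case_names free lift]:
  obtains "fk 0 X" "gc X = Eps X" | X' where "X = srn id Suc X'" "gc X = X'"
  by (metis gc_def gc_lift lift_of_fresh)

lemma reds_epsgc: "reds (Eps (srn id Suc X)) X"
  using reds_rstep[OF r_epsgc, of X] by (simp add: srn_defs)

lemma reds_Eps_gc: "reds (Eps X) (gc X)"
  by (cases X rule: gc_cases) (auto intro: reds_epsgc)

lemma reds_lift_inv:
  assumes "reds (srn id Suc X) Y"
  obtains Y' where "Y = srn id Suc Y'" "reds X Y'"
proof -
  from assms have "\<not> fk 0 Y" using fk_reds fk_lift(1) by blast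
  have "(\<lambda>n. n - 1) \<circ> Suc = id" by auto
  with reds_srn[OF assms, of id "\<lambda>n. n - 1"] have "reds X (srn id (\<lambda>n. n - 1) Y)"
    by simp
  with lift_of_fresh[OF \<open>\<not> fk 0 Y\<close>] that show ?thesis by blast
qed

text \<open>If the last throw to the block disappears during the reduction, the block is collected
  at the end; if there was none, none can appear.\<close>

lemma reds_gc: "reds X Y \<Longrightarrow> reds (gc X) (gc Y)"
proof (cases X rule: gc_cases)
  case free
  assume "reds X Y"
  with free show ?thesis by (metis reds_Eps reds_Eps_gc reds_trans)
next
  case (lift X')
  assume "reds X Y"
  with lift show ?thesis by (metis gc_lift reds_lift_inv)
qed

lemma reds_Wh_gc: "reds (Wh P (gc X)) (gc (Wh (srn id Suc P) (repl 0 (srn id Suc P) X)))"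
proof (cases X rule: gc_cases)
  case free
  have "reds (Wh P (Eps X)) (Eps (Wh (srn id Suc P) (repl 0 (srn id Suc P) X)))"
    using reds_rstep[OF r_wheps, of P X] by (simp add: srn_defs)
  with free show ?thesis by (metis reds_Eps_gc reds_trans)
next
  case (lift X')
  have "gc (srn id Suc (Wh P X')) = Wh P X'" by (rule gc_lift)
  with lift show ?thesis by (simp add: repl_fresh)
qed

lemma reds_gc_Wh: "reds (Wh (gc X) P) (gc (Wh X (srn id Suc P)))"
proof (cases X rule: gc_cases)
  case free
  have "reds (Wh (Eps X) P) (Eps (Wh X (srn id Suc P)))"
    using reds_sc[OF sc_eps, of X P] by (simp add: srn_defs)
  with free show ?thesis by (metis reds_Eps_gc reds_trans)
next
  case (lift X')
  have "gc (srn id Suc (Wh X' P)) = Wh X' P" by (rule gc_lift)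
  with lift show ?thesis by simp
qed

lemma mg_0_simps [simp]: "mg 0 l 0 = l" "mg 0 l (Suc k) = k"
  by (simp_all add: mg_0)

lemma rn_id_kv [simp]: "rnj id \<zeta> (kv k) = kv (\<zeta> k)" "rnj id \<zeta> \<circ> kv = kv \<circ> \<zeta>"
  by (simp_all add: kv_def fun_eq_iff)

lemma sb_V_kv [simp]: "sbj V (tx \<tau>) (kv k) = \<tau> k"
  using sb_kv_tx[of V] by simp

lemma mg_comp_Suc [simp]: "mg 0 l \<circ> Suc = id"
  by (simp add: mg_0)

lemma reds_Thr_gc: "reds (Thr l (gc X)) (Thr l (srn id (mg 0 l) X))"
proof (cases X rule: gc_cases)
  case free
  then show ?thesis using reds_rstep[OF r_threps, of l X] by (simp add: srn_defs)
qed simp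

lemma reds_gc_gc: "reds (gc (gc X)) (gc (srn id (mg 0 0) X))"
proof (cases X rule: gc_cases)
  case free
  show ?thesis
  proof (cases "Eps X" rule: gc_cases)
    case free
    have "reds (Eps (Eps X)) (Eps (srn id (mg 0 0) X))"
      using reds_rstep[OF r_epseps, of X] by (simp add: srn_defs)
    with free \<open>gc X = Eps X\<close> show ?thesis by (metis reds_Eps_gc reds_trans)
  next
    case (lift X')
    then obtain Y where "X' = Eps Y" "X = srn id (up Suc) Y" by (cases X') auto
    moreover have "mg 0 0 \<circ> up Suc = id" by (auto simp: fun_eq_iff mg_0 up_def split: nat.split)
    ultimately show ?thesis using lift \<open>gc X = Eps X\<close> by (simp add: reds_Eps_gc)
  qed
qed simp

lemma reds_gc_Thr0: "reds (gc (Thr 0 E)) (gc E)"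
proof -
  have "reds (Eps (Thr 0 E)) (Eps E)" by (intro reds_rstep r_epsthr)
  thus ?thesis using reds_Eps_gc[of E] by (auto simp: gc_def[of "Thr 0 E"] intro: reds_trans)
qed

definition thr :: "nat \<Rightarrow> trm \<Rightarrow> trm" where
  "thr l E = (if l = 0 then E else Thr l E)"

lemma reds_thr: "reds M N \<Longrightarrow> reds (thr l M) (thr l N)"
  by (simp add: thr_def reds_Thr)

lemma reds_gc_Thr: "reds (gc (Thr l E)) (gc (thr l E))"
  by (simp add: thr_def reds_gc_Thr0)

definition wh :: "trm \<Rightarrow> trm \<Rightarrow> trm" where
  "wh E A = (if E = Var 0 then A else Wh E A)"

lemma reds_Wh_wh: "reds (Wh E A) (wh E A)"
  by (auto simp: wh_def intro: reds_rstep r_letid)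

text \<open>
  A jump is a sequence of calls that ends by returning to its tail continuation \<open>tailk\<close>; \<open>rbj\<close> reads
  back what is returned there, and \<open>rbt\<close> reads back the whole jump as a term whose result is
  passed to continuation 0.
\<close>
primrec tailk :: "jmp \<Rightarrow> nat" where
  "tailk (Ret k W) = k"
| "tailk (Call A B J) = tailk J"

primrec rbv :: "val \<Rightarrow> trm" and rbj :: "jmp \<Rightarrow> trm" where
  "rbv (V i) = Var i"
| "rbv (Abs J) = Lam (gc (thr (tailk J) (rbj J)))"
| "rbj (Ret k W) = rbv W"
| "rbj (Call A B J) = wh (rbj J) (App (rbv A) (rbv B))"

definition rbt :: "jmp \<Rightarrow> trm" where
  "rbt J = gc (thr (tailk J) (rbj J))"

lemma is_val_rbv [simp]: "is_val (rbv W)"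
  by (cases W) auto

lemma tailk_rn [simp]: "tailk (rnj \<xi> \<zeta> J) = \<zeta> (tailk J)"
  by (induction J arbitrary: \<xi> rule: jmp.induct[of "\<lambda>_. True"]) auto

lemma tailk_vs [simp]: "tailk (vsj \<sigma> \<zeta> J) = \<zeta> (tailk J)"
  by (induction J arbitrary: \<sigma> rule: jmp.induct[of "\<lambda>_. True"]) auto

lemma ssb_gc: "ssb \<sigma> \<zeta> (gc X) = gc (ssb (srn id Suc \<circ> \<sigma>) (up \<zeta>) X)"
proof (cases X rule: gc_cases)
  case free
  have "fk 0 (ssb (srn id Suc \<circ> \<sigma>) (up \<zeta>) X)"
    using fk_ssbI[OF free(1), of "up \<zeta>"] by simp
  with free show ?thesis by (simp add: gc_def)
next
  case (lift X')
  have "ssb (srn id Suc \<circ> \<sigma>) (up \<zeta>) X = srn id Suc (ssb \<sigma> \<zeta> X')"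
    by (simp add: lift srn_ssb ssb_srn)
  with lift show ?thesis by simp
qed

lemma ssb_thr: "ssb \<sigma> (up \<zeta>) (thr l E) = thr (up \<zeta> l) (ssb \<sigma> (up \<zeta>) E)"
  by (auto simp: thr_def)

lemma ssb_wh: "ssb \<sigma> \<zeta> (wh E A) = wh (ssb (usx \<sigma>) \<zeta> E) (ssb \<sigma> \<zeta> A)"
proof -
  have "ssb (usx \<sigma>) \<zeta> E = Var 0 \<longleftrightarrow> E = Var 0"
  proof (cases E)
    case (Var i)
    \<comment> \<open>\<open>usx\<close> weakens the images of all variables but 0, so none of them
      can be \<open>Var 0\<close>.\<close>
    have "srn Suc id M \<noteq> Var 0" for M by (cases M) auto
    with Var show ?thesis by (cases i) (auto simp: usx_def)
  qed auto
  thus ?thesis by (simp add: wh_def)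
qed

lemma srn_gc: "srn \<xi> \<zeta> (gc X) = gc (srn \<xi> (up \<zeta>) X)"
  by (simp add: srn_eq_ssb ssb_gc srn_comp_Var[of id, unfolded srn_eq_ssb] comp_def)

lemma srn_thr: "srn \<xi> (up \<zeta>) (thr l E) = thr (up \<zeta> l) (srn \<xi> (up \<zeta>) E)"
  by (auto simp: thr_def)

lemma srn_wh: "srn \<xi> \<zeta> (wh E A) = wh (srn (up \<xi>) \<zeta> E) (srn \<xi> \<zeta> A)"
  by (simp add: srn_eq_ssb ssb_wh usx_Var)

lemma rb_rn: "rbv (rnv \<xi> \<zeta> W) = srn \<xi> \<zeta> (rbv W)" "rbj (rnj \<xi> \<zeta> J) = srn \<xi> \<zeta> (rbj J)"
  by (induction W and J arbitrary: \<xi> \<zeta> and \<xi> \<zeta>) (simp_all add: srn_gc srn_thr srn_wh)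

lemma rbt_rn: "rbt (rnj \<xi> (up \<zeta>) J) = srn \<xi> \<zeta> (rbt J)"
  by (simp add: rbt_def rb_rn srn_gc srn_thr)

lemma rbv_ux: "rbv \<circ> ux \<sigma> = usx (rbv \<circ> \<sigma>)"
  by (auto simp: fun_eq_iff ux_def usx_def rb_rn split: nat.split)

lemma rbv_ub: "rbv \<circ> ub \<sigma> = srn id Suc \<circ> usx (rbv \<circ> \<sigma>)"
  by (auto simp: fun_eq_iff ub_def usx_def rb_rn split: nat.split)

lemma rb_vs:
  "rbv (vsv \<sigma> \<zeta> W) = ssb (rbv \<circ> \<sigma>) \<zeta> (rbv W)" "rbj (vsj \<sigma> \<zeta> J) = ssb (rbv \<circ> \<sigma>) \<zeta> (rbj J)"
  by (induction W and J arbitrary: \<sigma> \<zeta> and \<sigma> \<zeta>)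
     (simp_all add: ssb_gc ssb_thr ssb_wh rbv_ux rbv_ub)

lemma rbv_case_nat: "rbv \<circ> case_nat W V = ins 0 (rbv W) Var"
  by (auto simp: fun_eq_iff ins_0 split: nat.split)

lemma rbj_inst: "rbj (inst W J) = subst_x 0 (rbv W) (rbj J)"
  by (simp add: inst_def rb_vs subst_x_ssb rbv_case_nat)

text \<open>W is shifted on the left because \<open>rbt\<close> binds continuation index 0 around J,
  whereas W stands outside.\<close>

lemma rbt_vs: "rbt (vsj (case_nat (rnv id Suc W) V) id J) = subst_x 0 (rbv W) (rbt J)"
proof -
  have "srn id Suc \<circ> ins 0 (rbv W) Var = ins 0 (srn id Suc (rbv W)) Var"
    by (auto simp: fun_eq_iff ins_def)
  moreover have "ssb \<sigma> id (thr l E) = thr l (ssb \<sigma> id E)" for \<sigma> l E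
    using ssb_thr[of \<sigma> id] by simp
  ultimately show ?thesis
    by (simp add: rbt_def subst_x_ssb ssb_gc rb_vs rbv_case_nat rb_rn)
qed

lemma repl_gc: "repl k P (gc X) = gc (repl (Suc k) (srn id Suc P) X)"
proof (cases X rule: gc_cases)
  case free
  with fk_replI[OF free(1), of "Suc k" "srn id Suc P"] show ?thesis by (simp add: gc_def srn_defs)
next
  case (lift X')
  have "srn id Suc (repl k P X') = repl (Suc k) (srn id Suc P) X"
    by (simp add: lift srn_repl)
  with lift show ?thesis by (metis gc_lift)
qed

lemma repl_wh: "repl k P (wh E A) = wh (repl k (srn (up Suc) id P) E) (repl k P A)"
proof -
  have "repl k (srn (up Suc) id P) E = Var 0 \<longleftrightarrow> E = Var 0" by (cases E) auto
  thus ?thesis by (auto simp: wh_def srn_defs)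
qed

lemma reds_wh:
  assumes "reds E E'" "reds A A'"
  shows "reds (wh E A) (wh E' A')"
proof (cases "E = Var 0")
  case True
  with assms show ?thesis using reds_VarD by (fastforce simp: wh_def)
next
  case False
  hence "reds (wh E A) (Wh E' A')" using assms by (simp add: wh_def reds_Wh)
  thus ?thesis using reds_Wh_wh reds_trans by blast
qed

lemma rbj_Var0: "rbj J = Var 0 \<Longrightarrow> J = kv (tailk J)"
proof (cases J)
  case (Ret k W)
  assume "rbj J = Var 0"
  with Ret show ?thesis by (cases W) (auto simp: kv_def)
qed (auto simp: wh_def split: if_splits)

section \<open>Read-back and substitution of continuations\<close>

lemma tx_fun_upd: "tx (\<tau>(k := K)) = (tx \<tau>)(k := rnj (up Suc) id K)"
  by (simp add: tx_def comp_fun_upd)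

lemma tb_fun_upd: "tb (\<tau>(k := K)) = (tb \<tau>)(Suc k := rnj (up Suc) Suc K)"
  by (simp add: tb_def comp_fun_upd fun_upd_case_nat)

text \<open>\<open>repl\<close> keeps the label k on the throws that it changes, so the inserted
  continuation must itself return to k. The tail return of J is not written in \<open>rbj J\<close>;
  if it goes to k, \<open>repl\<close> misses it and the let has to be added around the
  whole.\<close>

lemma rb_repl:
  "tailk K = k \<Longrightarrow> reds (repl k (rbj K) (rbv W)) (rbv (sbv V (kv(k := K)) W))"
  "tailk K = k \<Longrightarrow> tailk (sbj V (kv(k := K)) J) = tailk J \<and>
     reds (let E = repl k (rbj K) (rbj J) in if tailk J = k then Wh (rbj K) E else E)
       (rbj (sbj V (kv(k := K)) J))"
proof (induction W and J arbitrary: k K and k K)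
  case (Abs J)
  let ?K = "rnj (up Suc) Suc K"
  have "tailk ?K = Suc k" using Abs.prems by simp
  note IH = Abs.IH[OF this]
  \<comment> \<open>A tail equal to \<open>Suc k\<close> is not 0, so \<open>thr\<close> writes the
    throw, and \<open>repl\<close> supplies the let that the induction hypothesis asks for.\<close>
  have "reds (repl (Suc k) (rbj ?K) (thr (tailk J) (rbj J)))
    (thr (tailk J) (rbj (sbj V (kv(Suc k := ?K)) J)))"
    using IH by (auto simp: thr_def Let_def simp del: fun_upd_apply split: if_splits intro: reds_Thr)
  then show ?case
    using IH by (simp add: repl_gc srn_defs rb_rn tb_fun_upd reds_Lam reds_gc del: fun_upd_apply)
next
  case (Ret j U)
  have U: "reds (repl k (rbj K) (rbv U)) (rbv (sbv V (kv(k := K)) U))" by (rule Ret.IH[OF Ret.prems])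
  show ?case
  proof (cases "j = k")
    case True
    have "reds (Wh (rbj K) (rbv W)) (rbj (inst W K))" for W
      unfolding rbj_inst by (intro reds_rstep r_let is_val_rbv)
    with U have "reds (Wh (rbj K) (repl k (rbj K) (rbv U))) (rbj (inst (sbv V (kv(k := K)) U) K))"
      by (meson reds_Wh reds_refl reds_trans)
    moreover have "tailk (inst W K) = k" for W using Ret.prems by (simp add: inst_def)
    ultimately show ?thesis using True by (simp add: fun_upd_same del: fun_upd_apply)
  next
    case False
    with U show ?thesis by (simp add: fun_upd_other del: fun_upd_apply)
  qed
next
  case (Call A B J)
  let ?s = "kv(k := K)"
  let ?K = "rnj (up Suc) id K"
  let ?A = "App (repl k (rbj K) (rbv A)) (repl k (rbj K) (rbv B))"
  let ?E = "repl k (rbj ?K) (rbj J)"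
  have "tailk ?K = k" using Call.prems by simp
  note IH = Call.IH(3)[OF this]
  have A: "reds ?A (App (rbv (sbv V ?s A)) (rbv (sbv V ?s B)))"
    by (intro reds_App Call.IH Call.prems)
  have P: "srn (up Suc) id (rbj K) = rbj ?K" by (simp add: rb_rn)
  have tl: "tailk (sbj V ?s (Call A B J)) = tailk (Call A B J)"
    using IH by (simp add: tx_fun_upd del: fun_upd_apply)
  have "reds (let E = repl k (rbj K) (rbj (Call A B J)) in if tailk J = k then Wh (rbj K) E else E)
    (wh (rbj (sbj V (kv(k := ?K)) J)) (App (rbv (sbv V ?s A)) (rbv (sbv V ?s B))))"
  proof (cases "tailk J = k")
    case True
    show ?thesis
    proof (cases "rbj J = Var 0")
      case v: True
      \<comment> \<open>The call is in tail position: it is read back as a bare application, and K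
        becomes its continuation.\<close>
      hence J: "J = kv k" using rbj_Var0 True by blast
      have "sbj V (kv(k := ?K)) J = K"
        unfolding J by (simp add: kv_def)
      moreover have "reds (Wh (rbj K) ?A) (wh (rbj K) (App (rbv (sbv V ?s A)) (rbv (sbv V ?s B))))"
        using A by (meson reds_Wh reds_Wh_wh reds_refl reds_trans)
      ultimately show ?thesis using True v by (simp add: repl_wh) (simp add: wh_def)
    next
      case False
      have "?E \<noteq> Var 0" using False by (cases "rbj J") auto
      hence "repl k (rbj K) (rbj (Call A B J)) = Wh ?E ?A"
        unfolding rbj.simps repl_wh P by (simp add: wh_def)
      \<comment> \<open>The let that runs K after the whole jump moves into the continuation of the
        first call.\<close>
      moreover have "reds (Wh (rbj K) (Wh ?E ?A)) (Wh (Wh (rbj ?K) ?E) ?A)"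
        using reds_sc[OF sc_assoc, of "rbj K" ?E ?A] by (simp add: srn_defs P)
      moreover have "reds (Wh (Wh (rbj ?K) ?E) ?A)
        (wh (rbj (sbj V (kv(k := ?K)) J)) (App (rbv (sbv V ?s A)) (rbv (sbv V ?s B))))"
        using IH True A
        by (simp add: Let_def del: fun_upd_apply) (blast intro: reds_trans reds_Wh reds_Wh_wh)
      ultimately show ?thesis using True by (auto intro: reds_trans)
    qed
  next
    case False
    with IH A show ?thesis by (simp add: repl_wh P reds_wh del: fun_upd_apply)
  qed
  with tl show ?case by (simp add: tx_fun_upd del: repl.simps fun_upd_apply)
qed simp_all

text \<open>\<open>stk\<close> replaces the tail continuation by a fresh one with index 0.\<close>
primrec stk :: "jmp \<Rightarrow> jmp" where
  "stk (Ret k W) = Ret 0 (rnv id Suc W)"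
| "stk (Call A B J) = Call (rnv id Suc A) (rnv id Suc B) (stk J)"

lemma tailk_stk [simp]: "tailk (stk K) = 0"
  by (induction K rule: jmp.induct[of "\<lambda>_. True"]) auto

lemma rbj_stk: "rbj (stk K) = srn id Suc (rbj K)"
  by (induction K rule: jmp.induct[of "\<lambda>_. True"]) (simp_all add: rb_rn srn_wh del: id_apply)

lemma rnj_stk: "rnj id (mg 0 (tailk K)) (stk K) = K"
  by (induction K rule: jmp.induct[of "\<lambda>_. True"]) (simp_all del: id_apply)

text \<open>The let is pushed into the block of \<open>rbt J\<close>. \<open>stk K\<close> returns
  to the name of that block, as \<open>rb_repl\<close> demands, and from then on this name stands
  for the unwritten return of \<open>rbj K\<close>.\<close>

lemma reds_Wh_rbj: "reds (Wh (rbj K) (rbt J)) (rbt (sbj V (kv(0 := stk K)) J))"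
proof -
  let ?P = "srn id Suc (rbj K)"
  have IH: "tailk (sbj V (kv(0 := stk K)) J) = tailk J"
     "reds (if tailk J = 0 then Wh ?P (repl 0 ?P (rbj J)) else repl 0 ?P (rbj J))
       (rbj (sbj V (kv(0 := stk K)) J))"
    using rb_repl(2)[of "stk K" 0 J] unfolding rbj_stk Let_def by simp_all
  have "reds (Wh ?P (repl 0 ?P (thr (tailk J) (rbj J)))) (thr (tailk J) (rbj (sbj V (kv(0 := stk K)) J)))"
  proof (cases "tailk J = 0")
    case True
    with IH(2) show ?thesis by (simp add: thr_def)
  next
    case False
    \<comment> \<open>The body throws past the block, so the let around it is discarded.\<close>
    with IH(2) show ?thesis
      by (simp add: thr_def) (rule reds_trans[OF reds_rstep[OF r_whthr] reds_Thr])
  qed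
  from reds_trans[OF reds_Wh_gc reds_gc[OF this]] show ?thesis
    by (simp add: rbt_def IH(1))
qed

text \<open>The block around the read-back of H merges with what encloses it, by
  \<open>r_epseps\<close> if l is 0 and by \<open>r_threps\<close> otherwise. If H ends in a throw
  of its own, \<open>r_thrthr\<close> lets that throw win over the one to l.\<close>

lemma reds_close:
  assumes "reds E (rbt H)"
  shows "reds (gc (thr l E)) (rbt (rnj id (mg 0 l) H))"
proof -
  let ?h = "tailk H"
  let ?F = "srn id (mg 0 l) (rbj H)"
  have R: "rbt (rnj id (mg 0 l) H) = gc (thr (mg 0 l ?h) ?F)"
    by (simp add: rbt_def rb_rn)
  have 1: "reds (gc (thr l E)) (gc (thr l (gc (thr ?h (rbj H)))))"
    using assms by (intro reds_gc reds_thr) (simp add: rbt_def)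
  have 2: "reds (gc (thr l (gc X))) (gc (thr l (srn id (mg 0 l) X)))" for X
    by (auto simp: thr_def intro: reds_gc_gc reds_gc reds_Thr_gc)
  have 3: "reds (gc (thr l (srn id (mg 0 l) (thr ?h (rbj H))))) (gc (thr (mg 0 l ?h) ?F))"
  proof (cases ?h)
    case 0
    then show ?thesis by (simp add: thr_def mg_0)
  next
    case (Suc i)
    have "reds (thr l (Thr i ?F)) (Thr i ?F)"
      by (auto simp: thr_def intro: reds_rstep r_thrthr)
    from reds_trans[OF reds_gc[OF this] reds_gc_Thr] show ?thesis
      using Suc by (simp add: thr_def[of "Suc i"] mg_0)
  qed
  show ?thesis unfolding R using 1 2 3 by (blast intro: reds_trans)
qed

text \<open>The block and the tail throw of L move outwards, \<open>reds_Wh_rbj\<close> absorbs the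
  let, and the return of the result is then identified with the tail of L.\<close>

lemma reds_Wh_rbt: "reds (Wh (rbt L) (rbt M)) (rbt (sbj V (case_nat L (kv \<circ> Suc)) M))"
proof -
  let ?l = "tailk L"
  \<comment> \<open>M passes under the block of L: its own return 0 stays, the other names are
    shifted.\<close>
  let ?M = "rnj id (up Suc) M"
  have "reds (Wh (rbt L) (rbt M)) (gc (Wh (thr ?l (rbj L)) (rbt ?M)))"
    unfolding rbt_rn unfolding rbt_def[of L] by (rule reds_gc_Wh)
  also have "reds (Wh (thr ?l (rbj L)) (rbt ?M)) (thr ?l (Wh (rbj L) (rbt ?M)))"
    by (auto simp: thr_def intro: reds_sc sc_thr)
  hence "reds (gc (Wh (thr ?l (rbj L)) (rbt ?M))) (gc (thr ?l (Wh (rbj L) (rbt ?M))))"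
    by (rule reds_gc)
  also have "reds \<dots> (rbt (rnj id (mg 0 ?l) (sbj V (kv(0 := stk L)) ?M)))"
    by (intro reds_close reds_Wh_rbj)
  also have "rnj id (mg 0 ?l) (sbj V (kv(0 := stk L)) ?M) = sbj V (case_nat L (kv \<circ> Suc)) M"
  proof -
    have "rnj (up id) (mg 0 ?l) \<circ> (kv(0 := stk L) \<circ> up Suc) = case_nat L (kv \<circ> Suc)"
    proof
      fix i show "(rnj (up id) (mg 0 ?l) \<circ> (kv(0 := stk L) \<circ> up Suc)) i = case_nat L (kv \<circ> Suc) i"
        by (cases i) (simp_all add: rnj_stk kv_def)
    qed
    thus ?thesis by (simp add: comp_assoc)
  qed
  finally show ?thesis .
qed

lemma rbt_Var0:
  assumes "rbt H = Var 0"
  shows "H = kv 0"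
proof -
  let ?X = "thr (tailk H) (rbj H)"
  have "?X = Var 0"
  proof (cases ?X rule: gc_cases)
    case free
    with assms show ?thesis by (simp add: rbt_def)
  next
    case (lift X')
    with assms have "X' = Var 0" by (simp add: rbt_def)
    with lift show ?thesis by simp
  qed
  hence "tailk H = 0" "rbj H = Var 0" by (auto simp: thr_def split: if_splits)
  thus ?thesis using rbj_Var0 by metis
qed

lemma case_nat_kv [simp]: "case_nat (kv 0) (kv \<circ> Suc) = kv"
  by (auto simp: fun_eq_iff split: nat.split)

lemma reds_wh_rbt:
  assumes "reds E (rbt H)" "reds A (rbt M)"
  shows "reds (wh E A) (rbt (sbj V (case_nat H (kv \<circ> Suc)) M))"
proof (cases "E = Var 0")
  case True
  with assms(1) have "H = kv 0" using reds_VarD rbt_Var0 by blast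
  with True assms(2) show ?thesis by (simp add: wh_def)
next
  case False
  with assms show ?thesis
    by (auto simp: wh_def intro: reds_trans[OF reds_Wh reds_Wh_rbt])
qed

lemma rbt_Call_kv: "rbt (Call (rnv id Suc A) (rnv id Suc B) (kv 0)) = App (rbv A) (rbv B)"
proof -
  have "rbt (Call (rnv id Suc A) (rnv id Suc B) (kv 0)) = gc (srn id Suc (App (rbv A) (rbv B)))"
    by (simp add: rbt_def thr_def wh_def kv_def rb_rn)
  thus ?thesis by (simp only: gc_lift)
qed

lemma rbt_Ret: "rbt (Ret 0 (rnv id Suc W)) = rbv W"
  by (simp add: rbt_def thr_def rb_rn)

text \<open>
  A beta step may change the tail continuation and may copy it into values, so \<open>rbj J\<close> need not
  reduce to \<open>rbj J'\<close>. It does reduce to a term that names its own return continuation, and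
  \<open>J'\<close> arises by identifying this name with the tail of \<open>J\<close>.
\<close>
lemma rb_par:
  "parv W W' \<Longrightarrow> reds (rbv W) (rbv W')"
  "parj J J' \<Longrightarrow> \<exists>H. rnj id (mg 0 (tailk J)) H = J' \<and> reds (rbj J) (rbt H)"
proof (induction rule: parv_parj.inducts)
  case (par_V i)
  show ?case by simp
next
  case (par_Abs J J')
  then obtain H where H: "rnj id (mg 0 (tailk J)) H = J'" "reds (rbj J) (rbt H)" by blast
  from reds_close[OF H(2), of "tailk J"] H(1) show ?case by (simp add: rbt_def reds_Lam)
next
  case (par_eta W W')
  have "rbv (Abs (Call (rnv Suc Suc W) (V 0) (kv 0))) = Lam (rbt (Call (rnv id Suc (rnv Suc id W)) (rnv id Suc (V 0)) (kv 0)))"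
    by (simp add: rbt_def)
  also have "\<dots> = Lam (App (lift_x 0 (rbv W)) (Var 0))"
    unfolding rbt_Call_kv by (simp add: rb_rn srn_defs)
  finally have "reds (rbv (Abs (Call (rnv Suc Suc W) (V 0) (kv 0)))) (rbv W)"
    by (simp add: reds_rstep r_eta)
  from reds_trans[OF this par_eta.IH] show ?case .
next
  case (par_Ret W W' k)
  \<comment> \<open>The witness returns to its own name 0, which the shift keeps out of W';
    \<open>mg\<close> then sends 0 to k.\<close>
  show ?case
    by (intro exI[of _ "Ret 0 (rnv id Suc W')"]) (use par_Ret.IH in \<open>simp add: rbt_Ret del: id_apply\<close>)
next
  case (par_Call A A' B B' J J')
  then obtain H where H: "rnj id (mg 0 (tailk J)) H = J'" "reds (rbj J) (rbt H)" by blast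
  have "reds (App (rbv A) (rbv B)) (rbt (Call (rnv id Suc A') (rnv id Suc B') (kv 0)))"
    unfolding rbt_Call_kv by (intro reds_App par_Call.IH)
  from reds_wh_rbt[OF H(2) this]
  have "reds (rbj (Call A B J)) (rbt (Call (rnv id Suc A') (rnv id Suc B') H))" by simp
  with H(1) show ?case by (intro exI[of _ "Call (rnv id Suc A') (rnv id Suc B') H"]) (simp del: id_apply)
next
  case (par_beta J J' B B' K K')
  then obtain H where H: "rnj id (mg 0 (tailk K)) H = K'" "reds (rbj K) (rbt H)" by blast
  \<comment> \<open>Only the ordinary variable is instantiated here. Index 0 of J' remains as the
    return of the read-back, and H is attached to it in the next step.\<close>
  let ?M = "vsj (case_nat (rnv id Suc B') V) id J'"
  from par_beta.IH(1) have "reds (rbt J) (rbt J')" using reds_close rbt_def by metis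
  hence "reds (App (Lam (rbt J)) (rbv B)) (App (Lam (rbt J')) (rbv B'))"
    by (intro reds_App reds_Lam par_beta.IH)
  also have "reds \<dots> (Wh (rbt J') (rbv B'))" by (intro reds_rstep r_beta is_val_rbv)
  also have "reds \<dots> (subst_x 0 (rbv B') (rbt J'))" by (intro reds_rstep r_let is_val_rbv)
  also have "\<dots> = rbt ?M" by (rule rbt_vs[symmetric])
  finally have "reds (App (Lam (rbt J)) (rbv B)) (rbt ?M)" .
  from reds_wh_rbt[OF H(2) this]
  have "reds (rbj (Call (Abs J) B K)) (rbt (sbj V (case_nat H (kv \<circ> Suc)) ?M))"
    by (simp add: rbt_def)
  moreover have "rnj id (mg 0 (tailk K)) (sbj V (case_nat H (kv \<circ> Suc)) ?M) =
    sbj (case_nat B' V) (case_nat K' kv) J'"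
  proof -
    \<comment> \<open>Identifying the return of H with the tail of K yields K', and the shift of the
      other names is undone.\<close>
    have "rnj (up id) (mg 0 (tailk K)) \<circ> (case_nat H (kv \<circ> Suc)) = case_nat K' kv"
    proof
      fix i show "(rnj (up id) (mg 0 (tailk K)) \<circ> (case_nat H (kv \<circ> Suc))) i = case_nat K' kv i"
        using H(1) by (cases i) (simp_all add: mg_0 kv_def)
    qed
    moreover have "sbv V (case_nat K' kv) (rnv id Suc B') = B'" by simp
    ultimately show ?thesis by (simp add: comp_case_nat)
  qed
  ultimately show ?case
    by (intro exI[of _ "sbj V (case_nat H (kv \<circ> Suc)) ?M"]) (simp only: tailk.simps simp_thms)
qed

lemma reds_rbt_parj: "parj J J' \<Longrightarrow> reds (rbt J) (rbt J')"
  using rb_par(2) reds_close rbt_def by metis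

lemma reds_rbt_parjs: "parj\<^sup>*\<^sup>* J J' \<Longrightarrow> reds (rbt J) (rbt J')"
  by (induction rule: rtranclp_induct) (auto intro: reds_trans reds_rbt_parj)

text \<open>Index 0 is the return, as in \<open>rbt\<close>, so the free continuation variables
  start at 1.\<close>

definition nf :: "trm \<Rightarrow> jmp" where
  "nf M = cps M V (kv \<circ> Suc) (kv 0)"

text \<open>This is the very substitution in which \<open>reds_Wh_rbt\<close> ends.\<close>

lemma nf_Wh: "nf (Wh L M) = sbj V (case_nat (nf L) (kv \<circ> Suc)) (nf M)"
proof -
  have "sbj (ux V) (tx (case_nat J (kv \<circ> Suc))) \<circ> (kv \<circ> Suc) = kv \<circ> Suc" for J
    unfolding comp_assoc[symmetric] comp_kv(3) by simp
  moreover have "sbj (ux V) (tx (case_nat J (kv \<circ> Suc))) (kv 0) = J" for J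
    by (simp only: sb_kv_tx) simp
  ultimately show ?thesis
    unfolding nf_def sb_cps by simp
qed

lemma reds_nf_Wh:
  "reds L (rbt (nf L)) \<Longrightarrow> reds M (rbt (nf M)) \<Longrightarrow> reds (Wh L M) (rbt (nf (Wh L M)))"
  unfolding nf_Wh by (blast intro: reds_trans reds_Wh reds_Wh_rbt)

lemma nf_val: "is_val A \<Longrightarrow> nf A = Ret 0 (rnv id Suc (cv A V kv))"
  by (simp add: nf_def cps_val rn_cv comp_assoc)

lemma reds_nf_App_val:
  assumes "is_val A" "is_val B" "reds A (rbt (nf A))" "reds B (rbt (nf B))"
  shows "reds (App A B) (rbt (nf (App A B)))"
proof -
  have "nf (App A B) = Call (rnv id Suc (cv A V kv)) (rnv id Suc (cv B V kv)) (kv 0)"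
    using assms(1,2) by (simp add: nf_def cps_App_val rn_cv del: cps.simps)
  hence "rbt (nf (App A B)) = App (rbt (nf A)) (rbt (nf B))"
    using assms(1,2) by (simp add: nf_val rbt_Ret rbt_Call_kv)
  with assms(3,4) show ?thesis by (simp add: reds_App)
qed

lemma reds_nf_lift_x: "reds N (rbt (nf N)) \<Longrightarrow> reds (lift_x c N) (rbt (nf (lift_x c N)))"
proof -
  assume "reds N (rbt (nf N))"
  hence "reds (srn (sh c) id N) (rbt (rnj (sh c) (up id) (nf N)))"
    unfolding rbt_rn by (rule reds_srn)
  moreover have "rnj (sh c) (up id) (nf N) = nf (lift_x c N)"
  proof -
    have "rnj (up (sh c)) id \<circ> (kv \<circ> Suc) = kv \<circ> Suc" by (simp add: fun_eq_iff)
    thus ?thesis by (simp add: nf_def rn_cps cps_lift_x)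
  qed
  ultimately show ?thesis by (simp add: lift_x_srn)
qed

lemma reds_nf_Var: "reds (Var i) (rbt (nf (Var i)))"
  using rbt_Ret[of "V i"] by (simp add: nf_def)

text \<open>A function or argument that is no value is first named by a let. The translation does
  not see this, so lets and applications of values suffice.\<close>

lemma reds_nf_App:
  assumes "reds M (rbt (nf M))" "reds N (rbt (nf N))"
  shows "reds (App M N) (rbt (nf (App M N)))"
proof -
  have val1: "reds (App A B) (rbt (nf (App A B)))"
    if "is_val A" "reds A (rbt (nf A))" "reds B (rbt (nf B))" for A B
  proof (cases "is_val B")
    case True
    with that show ?thesis by (blast intro: reds_nf_App_val)
  next
    case False
    let ?W = "Wh (App (lift_x 0 A) (Var 0)) B"
    have "reds (App A B) ?W" using that(1) False by (intro reds_rstep r_app2)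
    also have "reds ?W (rbt (nf ?W))"
      using that by (intro reds_nf_Wh reds_nf_App_val reds_nf_lift_x reds_nf_Var) simp_all
    also have "nf ?W = nf (App A B)" unfolding nf_def by (rule cps_app2[symmetric, OF that(1)])
    finally show ?thesis .
  qed
  show ?thesis
  proof (cases "is_val M")
    case True
    with assms val1 show ?thesis by blast
  next
    case False
    let ?W = "Wh (App (Var 0) (lift_x 0 N)) M"
    have "reds (App M N) ?W" using False by (intro reds_rstep r_app1)
    also have "reds ?W (rbt (nf ?W))"
      using assms by (intro reds_nf_Wh val1 reds_nf_lift_x reds_nf_Var) simp_all
    also have "nf ?W = nf (App M N)" unfolding nf_def by (rule cps_app1[symmetric])
    finally show ?thesis .
  qed
qed

lemma reds_nf: "reds M (rbt (nf M))"
proof (induction M)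
  case (Var i)
  show ?case by (rule reds_nf_Var)
next
  case (Lam M)
  have "rnj (up Suc) Suc \<circ> kv = kv \<circ> Suc" by (simp add: fun_eq_iff)
  hence "rbv (cv (Lam M) V kv) = Lam (rbt (nf M))"
    by (simp add: rbt_def nf_def)
  moreover have "rbt (nf (Lam M)) = rbv (cv (Lam M) V kv)"
    by (simp only: nf_val is_val.simps rbt_Ret)
  ultimately show ?case using Lam by (simp add: reds_Lam)
next
  case (Eps M)
  \<comment> \<open>In \<open>nf M\<close> the return is 0 and the name bound by the block is 1; in
    \<open>nf (Eps M)\<close> both are the return.\<close>
  have "rnj id (mg 0 0) (nf M) = nf (Eps M)"
  proof -
    have "rnj (up id) (mg 0 0) \<circ> (kv \<circ> Suc) = kv" by (simp add: fun_eq_iff kv_def)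
    thus ?thesis by (simp add: nf_def rn_cps)
  qed
  with reds_close[OF Eps, of 0] show ?case
    by (auto simp: thr_def intro: reds_trans reds_Eps_gc)
next
  case (Thr k M)
  have "gc (thr (Suc k) (srn id Suc M)) = gc (srn id Suc (Thr k M))" by (simp add: thr_def)
  hence "gc (thr (Suc k) (srn id Suc M)) = Thr k M" by (simp only: gc_lift)
  moreover have "reds (srn id Suc M) (rbt (rnj id (up Suc) (nf M)))"
    unfolding rbt_rn using Thr by (rule reds_srn)
  moreover have "rnj id (mg 0 (Suc k)) (rnj id (up Suc) (nf M)) = nf (Thr k M)"
  proof -
    have "rnj (up id) (mg 0 (Suc k) \<circ> up Suc) \<circ> (kv \<circ> Suc) = kv \<circ> Suc"
      by (simp add: fun_eq_iff kv_def)
    thus ?thesis by (simp add: nf_def rn_cps rnj_comp_rnj)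
  qed
  ultimately show ?case using reds_close by metis
qed (blast intro: reds_nf_App reds_nf_Wh)+

theorem theorem4p6:
  assumes "conv M1 M2"
  shows "\<exists>N. reds M1 N \<and> reds M2 N"
proof -
  have "equivclp parj (nf M1) (nf M2)"
    unfolding nf_def by (rule cps_conv[OF assms])
  then obtain P where "parj\<^sup>*\<^sup>* (nf M1) P" "parj\<^sup>*\<^sup>* (nf M2) P"
    using semiconfluentp_equivclp[OF confluentp_imp_semiconfluentp[OF confluentp_parj]]
    by (auto simp: rtranclp_conversep)
  hence "reds M1 (rbt P)" "reds M2 (rbt P)"
    using reds_nf reds_rbt_parjs reds_trans by blast+
  thus ?thesis by blast
qed

end
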